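(* The problem $\textsc{RTSt}_{\mathbf{1}}$ with uncertainty set $\mathcal{U}^{\mathcal{HP}}=\{\underline{\mathbf{c}}+\boldsymbol{\delta}:\mathbf{A}\boldsymbol{\delta}\le\mathbf{b},\boldsymbol{\delta}\ge\mathbf{0}\}$ can be solved in polynomial time if the matrix $\mathbf{A}$ has a constant number of rows.
   Context: $\textsc{RTSt}_{\mathbf{1}}$: given $n$, first-stage costs $\mathbf{C}\in\mathbb{R}^n_{\ge0}$ and an uncertainty set $\mathcal{U}\subset\mathbb{R}^n_+$, solve $\min_{\mathbf{x}\in\{0,1\}^n}\big(\mathbf{C}^T\mathbf{x}+\max_{\mathbf{c}\in\mathcal{U}}\mathbf{c}^T(\mathbf{1}-\mathbf{x})\big)$. The set $\mathcal{U}^{\mathcal{HP}}\subset\mathbb{R}^n_+$ is assumed nonempty and bounded, with $\mathbf{A}\in\mathbb{R}^{m\times n}$, $\mathbf{b}\in\mathbb{R}^m$. *)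

theory Defs
  imports
    Jordan_Normal_Form.Matrix
    "HOL-Computational_Algebra.Polynomial"
    "HOL-Library.Log_Nat"
begin

section \<open>Two-stage selection of all elements with an uncertain second stage\<close>

text \<open>
  The second-stage solution is forced to be \<open>1 - x\<close>.  In the instances considered below the
  uncertainty set is nonempty and compact, so the supremum is a maximum.
\<close>

definition binary_vecs :: "nat \<Rightarrow> real vec set" where
  "binary_vecs n = {x \<in> carrier_vec n. \<forall>i<n. x $ i = 0 \<or> x $ i = 1}"

definition rtst_cost :: "real vec \<Rightarrow> real vec set \<Rightarrow> real vec \<Rightarrow> real" where
  "rtst_cost C U x = C \<bullet> x + (SUP c\<in>U. c \<bullet> (vec (dim_vec C) (\<lambda>_. 1) - x))"

definition rtst_optimal :: "real vec \<Rightarrow> real vec set \<Rightarrow> real vec \<Rightarrow> bool" where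
  "rtst_optimal C U x \<longleftrightarrow> is_arg_min (rtst_cost C U) (\<lambda>y. y \<in> binary_vecs (dim_vec C)) x"

definition U_HP :: "real vec \<Rightarrow> real mat \<Rightarrow> real vec \<Rightarrow> real vec set" where
  "U_HP cl A b = {cl + \<delta> | \<delta>. \<delta> \<in> carrier_vec (dim_col A) \<and> A *\<^sub>v \<delta> \<le> b \<and> \<delta> \<ge> 0\<^sub>v (dim_col A)}"

definition bounded_vecs :: "nat \<Rightarrow> real vec set \<Rightarrow> bool" where
  "bounded_vecs n U \<longleftrightarrow> (\<exists>B. \<forall>c\<in>U. \<forall>i<n. \<bar>c $ i\<bar> \<le> B)"


section \<open>Polynomial time\<close>

text \<open>
  The machine model is a random access machine with integer cells and logarithmic cost, programmed
  by structured commands.  The store consists of arrays; every array is named by a natural number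
  and indexed by all integers, and a program mentions finitely many arrays.  An array access
  at a computed index is the usual indirect addressing.  Every evaluated subexpression is charged
  the bit length of its value, so that iterated multiplication is not cheap and the model is
  polynomially equivalent to Turing machines.
\<close>

definition int_size :: "int \<Rightarrow> nat" where
  "int_size z = Suc (floorlog 2 (nat \<bar>z\<bar>))"

definition list_size :: "int list \<Rightarrow> nat" where
  "list_size w = (\<Sum>z\<leftarrow>w. int_size z)"

type_synonym store = "nat \<Rightarrow> int \<Rightarrow> int"

datatype aexp =
    Lit int
  | Cell nat aexp
  | Plus aexp aexp
  | Minus aexp aexp
  | Times aexp aexp

datatype bexp =
    Less aexp aexp
  | Neg bexp
  | Conj bexp bexp

datatype com =
    Skip
  | Assign nat aexp aexp
  | Seq com com
  | Cond bexp com com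
  | Loop bexp com

fun aval :: "aexp \<Rightarrow> store \<Rightarrow> int" where
  "aval (Lit z) s = z"
| "aval (Cell a e) s = s a (aval e s)"
| "aval (Plus e f) s = aval e s + aval f s"
| "aval (Minus e f) s = aval e s - aval f s"
| "aval (Times e f) s = aval e s * aval f s"

fun acost :: "aexp \<Rightarrow> store \<Rightarrow> nat" where
  "acost (Lit z) s = int_size z"
| "acost (Cell a e) s = acost e s + int_size (aval (Cell a e) s)"
| "acost (Plus e f) s = acost e s + acost f s + int_size (aval (Plus e f) s)"
| "acost (Minus e f) s = acost e s + acost f s + int_size (aval (Minus e f) s)"
| "acost (Times e f) s = acost e s + acost f s + int_size (aval (Times e f) s)"

fun bval :: "bexp \<Rightarrow> store \<Rightarrow> bool" where
  "bval (Less e f) s \<longleftrightarrow> aval e s < aval f s"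
| "bval (Neg b) s \<longleftrightarrow> \<not> bval b s"
| "bval (Conj b c) s \<longleftrightarrow> bval b s \<and> bval c s"

fun bcost :: "bexp \<Rightarrow> store \<Rightarrow> nat" where
  "bcost (Less e f) s = acost e s + acost f s + 1"
| "bcost (Neg b) s = bcost b s + 1"
| "bcost (Conj b c) s = bcost b s + bcost c s + 1"

text \<open>
  \<open>exec c s t s'\<close>: started in store \<open>s\<close>, the program \<open>c\<close> halts in store \<open>s'\<close> after time \<open>t\<close>.
  \<open>Assign a i e\<close> stores the value of \<open>e\<close> in array \<open>a\<close> at index \<open>i\<close>.
\<close>

inductive exec :: "com \<Rightarrow> store \<Rightarrow> nat \<Rightarrow> store \<Rightarrow> bool" where
  Skip: "exec Skip s 1 s"
| Assign: "exec (Assign a i e) s (acost i s + acost e s + 1) (s(a := (s a)(aval i s := aval e s)))"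
| Seq: "exec c s t s' \<Longrightarrow> exec d s' t' s'' \<Longrightarrow> exec (Seq c d) s (t + t' + 1) s''"
| CondTrue: "bval b s \<Longrightarrow> exec c s t s' \<Longrightarrow> exec (Cond b c d) s (bcost b s + t + 1) s'"
| CondFalse: "\<not> bval b s \<Longrightarrow> exec d s t s' \<Longrightarrow> exec (Cond b c d) s (bcost b s + t + 1) s'"
| LoopFalse: "\<not> bval b s \<Longrightarrow> exec (Loop b c) s (bcost b s + 1) s"
| LoopTrue: "bval b s \<Longrightarrow> exec c s t s' \<Longrightarrow> exec (Loop b c) s' t' s'' \<Longrightarrow>
    exec (Loop b c) s (bcost b s + t + t' + 1) s''"

inductive_cases exec_SkipE: "exec Skip s t s'"
inductive_cases exec_AssignE: "exec (Assign a i e) s t s'"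
inductive_cases exec_SeqE: "exec (Seq c d) s t s'"
inductive_cases exec_CondE: "exec (Cond b c d) s t s'"
inductive_cases exec_LoopE: "exec (Loop b c) s t s'"

lemma exec_deterministic:
  "exec c s t s' \<Longrightarrow> exec c s u s'' \<Longrightarrow> u = t \<and> s'' = s'"
proof (induction arbitrary: u s'' rule: exec.induct)
  case (Seq c s t s' d t' s1)
  from Seq.prems obtain v r v' where "exec c s v r" "exec d r v' s''" "u = Suc (v + v')"
    by (rule exec_SeqE)
  with Seq.IH(1)[of v r] Seq.IH(2)[of v' s''] show ?case by simp
next
  case (CondTrue b s c t s' d)
  from CondTrue.prems show ?case by (rule exec_CondE) (auto simp: CondTrue.hyps dest: CondTrue.IH)
next
  case (CondFalse b s d t s' c)
  from CondFalse.prems show ?case by (rule exec_CondE) (auto simp: CondFalse.hyps dest: CondFalse.IH)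
next
  case (LoopFalse b s c)
  from LoopFalse.prems show ?case by (rule exec_LoopE) (simp_all add: LoopFalse.hyps)
next
  case (LoopTrue b s c t s' t' s1)
  from LoopTrue.prems obtain v r v'
    where "exec c s v r" "exec (Loop b c) r v' s''" "u = Suc (bcost b s + v + v')"
    by (rule exec_LoopE) (simp_all add: LoopTrue.hyps(1))
  with LoopTrue.IH(1)[of v r] LoopTrue.IH(2)[of v' s''] show ?case by simp
qed (erule exec_SkipE exec_AssignE; simp)+

text \<open>
  The input list is placed in array 0 and the output list is read off array 1, each preceded by
  its length in cell 0; all other cells are initially 0.
\<close>

definition input_store :: "int list \<Rightarrow> store" where
  "input_store w = (\<lambda>a i.
     if a = 0 \<and> i = 0 then int (length w)
     else if a = 0 \<and> 1 \<le> i \<and> i \<le> int (length w) then w ! (nat i - 1)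
     else 0)"

definition has_output :: "store \<Rightarrow> int list \<Rightarrow> bool" where
  "has_output s v \<longleftrightarrow> s 1 0 = int (length v) \<and> (\<forall>i<length v. s 1 (int i + 1) = v ! i)"

text \<open>
  A search problem is given by its set of instances, their encoding and the relation between
  instances and correct outputs.  The size of the output is counted as well, because cells that
  were never written could otherwise be output for free.
\<close>

definition poly_time_solvable ::
    "'i set \<Rightarrow> ('i \<Rightarrow> int list) \<Rightarrow> ('i \<Rightarrow> int list \<Rightarrow> bool) \<Rightarrow> bool" where
  "poly_time_solvable Insts enc sol \<longleftrightarrow>
     (\<exists>(prog :: com) (p :: nat poly). \<forall>I\<in>Insts. \<exists>t s v.
        exec prog (input_store (enc I)) t s \<and> has_output s v \<and> sol I v \<and>
        t + list_size v \<le> poly p (list_size (enc I)))"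


section \<open>The problem with rational data as a search problem\<close>

record rtst_hp =
  first_costs :: "rat vec"
  nominal_costs :: "rat vec"
  constr_mat :: "rat mat"
  constr_rhs :: "rat vec"

definition rC :: "rtst_hp \<Rightarrow> real vec" where
  "rC I = map_vec of_rat (first_costs I)"

definition rU :: "rtst_hp \<Rightarrow> real vec set" where
  "rU I = U_HP (map_vec of_rat (nominal_costs I)) (map_mat of_rat (constr_mat I))
     (map_vec of_rat (constr_rhs I))"

definition rtst_hp_instances :: "nat \<Rightarrow> rtst_hp set" where
  "rtst_hp_instances m = {I. \<exists>n.
     first_costs I \<in> carrier_vec n \<and> nominal_costs I \<in> carrier_vec n \<and>
     constr_mat I \<in> carrier_mat m n \<and> constr_rhs I \<in> carrier_vec m \<and>
     rC I \<ge> 0\<^sub>v n \<and>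
     rU I \<noteq> {} \<and> bounded_vecs n (rU I) \<and> (\<forall>c\<in>rU I. c \<ge> 0\<^sub>v n)}"

definition enc_rat :: "rat \<Rightarrow> int list" where
  "enc_rat r = (let (p, q) = quotient_of r in [p, q])"

definition enc_vec :: "rat vec \<Rightarrow> int list" where
  "enc_vec v = concat (map enc_rat (list_of_vec v))"

definition enc_rtst_hp :: "rtst_hp \<Rightarrow> int list" where
  "enc_rtst_hp I =
     [int (dim_vec (first_costs I)), int (dim_row (constr_mat I))] @
     enc_vec (first_costs I) @ enc_vec (nominal_costs I) @
     concat (map enc_vec (rows (constr_mat I))) @ enc_vec (constr_rhs I)"

text \<open>
  The output consists of the optimal value, as a fraction, followed by an optimal first-stage
  solution.
\<close>

definition rtst_hp_solution :: "rtst_hp \<Rightarrow> int list \<Rightarrow> bool" where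
  "rtst_hp_solution I v \<longleftrightarrow> (\<exists>p q xs. v = p # q # xs \<and> q > 0 \<and>
     (let x = map_vec real_of_int (vec_of_list xs) in
        rtst_optimal (rC I) (rU I) x \<and> rtst_cost (rC I) (rU I) x = of_int p / of_int q))"

end

theory Submission
  imports Defs "Jordan_Normal_Form.Determinant"
begin

text \<open>
  By linear programming duality the worst second-stage cost of a fixed \<open>x\<close> is the minimum of \<open>b \<bullet> p\<close> over
  \<open>p \<ge> 0\<close> with \<open>A\<^sup>T p \<ge> 1 - x\<close>, attained at a vertex of this polyhedron.  A vertex solves \<open>m\<close> equations
  \<open>a \<cdot> p = \<beta>\<close>, where \<open>a\<close> is a column of \<open>A\<close> or a unit vector and \<open>\<beta> \<in> {0, 1}\<close>; these systems do not depend
  on \<open>x\<close> and there are only \<open>(2 * (n + m)) ^ m\<close> of them.  For a fixed feasible \<open>p\<close> the best \<open>x\<close> is found item by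
  item: item \<open>i\<close> may be left to the second stage if and only if \<open>(A\<^sup>T p) i \<ge> 1\<close>.  The program enumerates the
  systems by \<open>2 * m\<close> nested loops, solves them by Cramer's rule over a common denominator, and keeps the
  best pair \<open>(p, x)\<close>.
\<close>

section \<open>Linear programming duality and vertices\<close>

text \<open>The cost of \<open>x\<close> contains a maximum; duality replaces it by a minimum over
  \<open>p\<close>, and two nested minima may be exchanged. Only then does one list of points
  \<open>p\<close>, common to all \<open>x\<close>, suffice, and its length is polynomial because
  \<open>m\<close> is fixed. The two halves of duality are used asymmetrically. Strong duality and
  vertices serve only to show that some candidate is at least as good as any given \<open>x\<close>.
  The formal obstacle is the machine: its cost is logarithmic and it cannot divide, so the bit
  length of every cell has to be bounded along the run. All data are therefore made integral by the
  product \<open>D\<close> of all denominators, which is no longer than the input, and fractions are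
  compared by cross multiplication. Each determinant is a single expression with
  \<open>fact m\<close> products, of constant size once \<open>m\<close> is fixed; it lengthens the
  numbers only by a factor depending on \<open>m\<close>. The running time then follows from the
  loop structure alone.\<close>

definition dot :: "nat \<Rightarrow> (nat \<Rightarrow> 'a::comm_ring_1) \<Rightarrow> (nat \<Rightarrow> 'a) \<Rightarrow> 'a" where
  "dot m u v = (\<Sum>j<m. u j * v j)"

lemma dot_add_right: "dot m u (\<lambda>j. v j + c * w j) = dot m u v + c * dot m u w"
  by (simp add: dot_def algebra_simps sum.distrib sum_distrib_left)

lemma dot_uminus_right: "dot m u (\<lambda>j. - w j) = - dot m u w"
  by (simp add: dot_def sum_negf)

lemma dot_unit: "k < m \<Longrightarrow> dot m (\<lambda>j. if j = k then 1 else 0) v = v k"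
  by (simp add: dot_def if_distrib[of "\<lambda>c. c * _"] cong: if_cong)

lemma dot_sum_swap: "dot n (\<lambda>i. dot m (a i) p) d = dot m (\<lambda>j. dot n (\<lambda>i. a i j) d) p"
  unfolding dot_def sum_distrib_right sum_distrib_left
  by (subst sum.swap) (simp add: mult_ac)

text \<open>Bartl's induction: if the last functional \<open>a n\<close> is needed, then some \<open>x0\<close> satisfies the others
  but violates the conclusion, and projecting along \<open>x0\<close> onto the kernel of \<open>a n\<close> removes it.\<close>

lemma farkas:
  fixes a :: "nat \<Rightarrow> nat \<Rightarrow> real"
  assumes "\<And>x. (\<And>i. i < n \<Longrightarrow> dot m (a i) x \<le> 0) \<Longrightarrow> dot m g x \<le> 0"
  shows "\<exists>l. (\<forall>i<n. l i \<ge> 0) \<and> (\<forall>j<m. g j = (\<Sum>i<n. l i * a i j))"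
  using assms
proof (induction n arbitrary: a g)
  case 0
  have "g j = 0" if "j < m" for j
  proof -
    \<comment> \<open>Without functionals the hypothesis holds for every \<open>x\<close>, in
      particular for \<open>g\<close> itself.\<close>
    have "dot m g g \<le> 0" using 0 by blast
    hence "(\<Sum>j<m. g j * g j) = 0"
      unfolding dot_def using sum_nonneg[of "{..<m}" "\<lambda>j. g j * g j"] by simp
    thus ?thesis using that by (subst (asm) sum_nonneg_eq_0_iff) auto
  qed
  thus ?case by auto
next
  case (Suc n)
  show ?case
  proof (cases "\<forall>x. (\<forall>i<n. dot m (a i) x \<le> 0) \<longrightarrow> dot m g x \<le> 0")
    case True
    with Suc.IH[of a g] obtain l where l: "\<forall>i<n. l i \<ge> 0" "\<forall>j<m. g j = (\<Sum>i<n. l i * a i j)" by blast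
    show ?thesis by (rule exI[of _ "l(n := 0)"]) (use l in \<open>auto simp: less_Suc_eq\<close>)
  next
    case False
    then obtain x1 where x1: "\<And>i. i < n \<Longrightarrow> dot m (a i) x1 \<le> 0" "dot m g x1 > 0" by force
    have pos: "dot m (a n) x1 > 0"
    proof (rule ccontr)
      assume "\<not> ?thesis"
      hence "dot m g x1 \<le> 0" by (intro Suc.prems) (auto simp: less_Suc_eq intro: x1)
      thus False using x1(2) by simp
    qed
    define x0 where "x0 = (\<lambda>j. x1 j / dot m (a n) x1)"
    have sc: "dot m u x0 = dot m u x1 / dot m (a n) x1" for u
      unfolding x0_def dot_def[of m u] by (simp add: sum_divide_distrib)
    have x0: "\<And>i. i < n \<Longrightarrow> dot m (a i) x0 \<le> 0" "dot m g x0 > 0" "dot m (a n) x0 = 1"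
      using x1 pos by (auto simp: sc divide_nonpos_pos)
    \<comment> \<open>Adjointness: projecting the functional \<open>u\<close> amounts to evaluating
      \<open>u\<close> at the projection of \<open>x\<close> along \<open>x0\<close> onto the kernel
      of \<open>a n\<close>.\<close>
    have proj: "dot m (\<lambda>j. u j - a n j * dot m u x0) x = dot m u (\<lambda>j. x j + (- dot m (a n) x) * x0 j)" for u x
      unfolding dot_add_right by (simp add: dot_def algebra_simps sum_subtractf sum_distrib_left)
    have "\<exists>l. (\<forall>i<n. l i \<ge> 0) \<and> (\<forall>j<m. g j - a n j * dot m g x0 = (\<Sum>i<n. l i * (a i j - a n j * dot m (a i) x0)))"
    proof (rule Suc.IH)
      fix x assume H: "\<And>i. i < n \<Longrightarrow> dot m (\<lambda>j. a i j - a n j * dot m (a i) x0) x \<le> 0"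
      show "dot m (\<lambda>j. g j - a n j * dot m g x0) x \<le> 0"
        unfolding proj
      proof (rule Suc.prems)
        fix i assume "i < Suc n"
        then consider "i < n" | "i = n" by linarith
        thus "dot m (a i) (\<lambda>j. x j + (- dot m (a n) x) * x0 j) \<le> 0"
        proof cases
          case 1 thus ?thesis using H[OF 1] proj[of "a i" x] by linarith
        next
          case 2 thus ?thesis unfolding dot_add_right by (simp add: x0)
        qed
      qed
    qed
    then obtain l where l: "\<forall>i<n. l i \<ge> 0"
      "\<forall>j<m. g j - a n j * dot m g x0 = (\<Sum>i<n. l i * (a i j - a n j * dot m (a i) x0))" by blast
    \<comment> \<open>Expanding the projected identity forces this coefficient of
      \<open>a n\<close>. It is nonnegative because \<open>x0\<close> satisfies the first
      \<open>n\<close> inequalities and violates the conclusion.\<close>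
    define c where "c = dot m g x0 - (\<Sum>i<n. l i * dot m (a i) x0)"
    have "(\<Sum>i<n. l i * dot m (a i) x0) \<le> 0"
      by (rule sum_nonpos) (use l x0 in \<open>auto intro: mult_nonneg_nonpos\<close>)
    hence c: "c \<ge> 0" using x0(2) unfolding c_def by linarith
    have "g j = (\<Sum>i<n. l i * a i j) + c * a n j" if "j < m" for j
    proof -
      have "g j = a n j * dot m g x0 + (\<Sum>i<n. l i * (a i j - a n j * dot m (a i) x0))"
        using l(2) that by fastforce
      also have "\<dots> = (\<Sum>i<n. l i * a i j) + c * a n j"
        by (simp add: c_def algebra_simps sum_subtractf sum_distrib_left)
      finally show ?thesis .
    qed
    thus ?thesis by (intro exI[of _ "l(n := c)"]) (use l c in \<open>auto simp: less_Suc_eq\<close>)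
  qed
qed

section \<open>Strong duality from Farkas' lemma\<close>

lemma sum_lessThan_add:
  fixes f :: "nat \<Rightarrow> 'a::comm_monoid_add"
  shows "sum f {..<m + n} = sum f {..<m} + (\<Sum>k<n. f (m + k))"
  by (induction n) (simp_all add: add.assoc)

text \<open>Farkas' lemma for the homogenised system, with one extra coordinate.\<close>

lemma lp_dual_certificate:
  fixes a :: "nat \<Rightarrow> nat \<Rightarrow> real"
  assumes ne: "\<forall>i<n. d0 i \<ge> 0" "\<forall>j<m. dot n (\<lambda>i. a i j) d0 \<le> b j"
    and bd: "\<And>d. (\<forall>i<n. d i \<ge> 0) \<Longrightarrow> (\<forall>j<m. dot n (\<lambda>i. a i j) d \<le> b j) \<Longrightarrow> dot n y d \<le> z"
  shows "\<exists>p. (\<forall>j<m. p j \<ge> 0) \<and> (\<forall>i<n. dot m (a i) p \<ge> y i) \<and> dot m b p \<le> z"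
proof -
  \<comment> \<open>Coordinate \<open>n\<close> is the homogenising one. Rows below \<open>m\<close>
    say \<open>a \<cdot> x \<le> b * x n\<close>; the other \<open>Suc n\<close> rows say that all
    coordinates, including the new one, are nonnegative.\<close>
  define A where "A = (\<lambda>k i. if k < m then (if i < n then a i k else - b k)
      else if k - m = i then -1 else (0::real))"
  define g where "g = (\<lambda>i. if i < n then y i else - z)"
  have dS: "dot (Suc n) u x = dot n u x + u n * x n" for u x :: "nat \<Rightarrow> real" by (simp add: dot_def)
  have A1: "dot (Suc n) (A k) x = dot n (\<lambda>i. a i k) x - b k * x n" if "k < m" for k x
    unfolding dS using that by (simp add: A_def dot_def)
  have A2: "dot (Suc n) (A (m + i)) x = - x i" if "i < Suc n" for i x
  proof -
    have "dot (Suc n) (A (m + i)) x = - dot (Suc n) (\<lambda>j. if j = i then 1 else 0) x"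
      unfolding dot_def A_def sum_negf[symmetric] by (rule sum.cong) auto
    thus ?thesis using dot_unit[OF that] by simp
  qed
  have G: "dot (Suc n) g x = dot n y x - z * x n" for x
    unfolding dS by (simp add: g_def dot_def)
  have "\<exists>l. (\<forall>k<m + Suc n. l k \<ge> 0) \<and> (\<forall>i<Suc n. g i = (\<Sum>k<m + Suc n. l k * A k i))"
  proof (rule farkas)
    fix x assume H: "\<And>k. k < m + Suc n \<Longrightarrow> dot (Suc n) (A k) x \<le> 0"
    have h1: "dot n (\<lambda>i. a i k) x \<le> b k * x n" if "k < m" for k
      using H[of k] A1[OF that, of x] that by simp
    have h2: "x i \<ge> 0" if "i < Suc n" for i
      using H[of "m + i"] A2[OF that, of x] that by simp
    show "dot (Suc n) g x \<le> 0"
    proof (cases "x n = 0")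
      case False
      hence p: "x n > 0" using h2[of n] by simp
      have sc: "dot n u (\<lambda>i. x i / x n) = dot n u x / x n" for u
        unfolding dot_def by (simp add: sum_divide_distrib)
      have "dot n y (\<lambda>i. x i / x n) \<le> z"
        using h1 h2 p by (intro bd) (auto simp: sc pos_divide_le_eq)
      thus ?thesis unfolding sc G using p by (simp add: pos_divide_le_eq)
    next
      case True
      \<comment> \<open>Here \<open>x\<close> is a recession direction: \<open>d0 + s * x\<close>
        stays feasible for every \<open>s \<ge> 0\<close>, so a positive slope of the objective
        would exceed \<open>z\<close> eventually.\<close>
      have ray: "dot n y d0 + s * dot n y x \<le> z" if "s \<ge> 0" for s
      proof -
        have "dot n y (\<lambda>i. d0 i + s * x i) \<le> z"
        proof (rule bd; intro allI impI)
          fix i assume "i < n" thus "0 \<le> d0 i + s * x i" using ne(1) h2[of i] that by simp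
        next
          fix j assume "j < m"
          hence "dot n (\<lambda>i. a i j) x \<le> 0" using h1[of j] True by simp
          hence "s * dot n (\<lambda>i. a i j) x \<le> 0" using that by (simp add: mult_nonneg_nonpos)
          thus "dot n (\<lambda>i. a i j) (\<lambda>i. d0 i + s * x i) \<le> b j"
            unfolding dot_add_right using ne(2) \<open>j < m\<close> by force
        qed
        thus ?thesis unfolding dot_add_right .
      qed
      have "dot n y x \<le> 0"
      proof (rule ccontr)
        assume "\<not> ?thesis"
        hence p: "dot n y x > 0" by simp
        define s where "s = (\<bar>z - dot n y d0\<bar> + 1) / dot n y x"
        have "s \<ge> 0" using p by (simp add: s_def)
        moreover have "s * dot n y x = \<bar>z - dot n y d0\<bar> + 1" using p by (simp add: s_def)
        ultimately show False using ray[of s] by linarith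
      qed
      thus ?thesis unfolding G using True by simp
    qed
  qed
  then obtain l where l: "\<forall>k<m + Suc n. l k \<ge> 0" "\<forall>i<Suc n. g i = (\<Sum>k<m + Suc n. l k * A k i)"
    by blast
  have split: "(\<Sum>k<m + Suc n. l k * A k i) = (\<Sum>k<m. l k * A k i) - l (m + i)" if "i < Suc n" for i
  proof -
    have "(\<Sum>k<m + Suc n. l k * A k i) = (\<Sum>k<m. l k * A k i) + (\<Sum>k<Suc n. l (m + k) * A (m + k) i)"
      by (rule sum_lessThan_add)
    also have "(\<Sum>k<Suc n. l (m + k) * A (m + k) i) = (\<Sum>k<Suc n. if k = i then - l (m + i) else 0)"
      by (rule sum.cong) (auto simp: A_def)
    finally show ?thesis using that by (simp del: sum.lessThan_Suc)
  qed
  show ?thesis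
  proof (intro exI conjI allI impI)
    show "l j \<ge> 0" if "j < m" for j using l(1) that by simp
    show "y i \<le> dot m (a i) l" if "i < n" for i
    proof -
      have "y i = (\<Sum>k<m. l k * A k i) - l (m + i)"
        using l(2)[rule_format, of i] that split[of i] by (simp add: g_def del: sum.lessThan_Suc)
      also have "(\<Sum>k<m. l k * A k i) = dot m (a i) l"
        unfolding dot_def by (rule sum.cong) (use that in \<open>auto simp: A_def\<close>)
      finally show ?thesis using l(1) that by simp
    qed
    have "- z = (\<Sum>k<m. l k * A k n) - l (m + n)"
      using l(2)[rule_format, of n] split[of n] by (simp add: g_def del: sum.lessThan_Suc)
    also have "(\<Sum>k<m. l k * A k n) = - dot m b l"
      unfolding dot_def sum_negf[symmetric] by (rule sum.cong) (auto simp: A_def)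
    finally have "- z = - dot m b l - l (m + n)" .
    moreover have "l (m + n) \<ge> 0" using l(1) by simp
    ultimately show "dot m b l \<le> z" by linarith
  qed
qed

text \<open>Among the feasible points no worse than \<open>p0\<close>, one with the most tight
  constraints is taken. A nonzero direction orthogonal to all tight rows could be followed, without
  increasing the objective, until a further constraint becomes tight, against maximality. The lower
  bound \<open>lo\<close> excludes endless descent, and \<open>pointed\<close> excludes moving along
  a line that meets no constraint.\<close>

lemma tight_point_with_trivial_kernel:
  fixes a :: "nat \<Rightarrow> nat \<Rightarrow> real"
  assumes pointed: "\<And>v. (\<forall>i<N. dot m (a i) v = 0) \<Longrightarrow> \<forall>j<m. v j = 0"
    and lb: "\<And>p. (\<forall>i<N. dot m (a i) p \<ge> \<beta> i) \<Longrightarrow> dot m b p \<ge> lo"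
    and p0: "\<forall>i<N. dot m (a i) p0 \<ge> \<beta> i"
  shows "\<exists>p. (\<forall>i<N. dot m (a i) p \<ge> \<beta> i) \<and> dot m b p \<le> dot m b p0 \<and>
    (\<forall>v. (\<forall>i<N. dot m (a i) p = \<beta> i \<longrightarrow> dot m (a i) v = 0) \<longrightarrow> (\<forall>j<m. v j = 0))"
proof -
  define F where "F = (\<lambda>p. (\<forall>i<N. dot m (a i) p \<ge> \<beta> i) \<and> dot m b p \<le> dot m b p0)"
  define T where "T = (\<lambda>p. {i\<in>{..<N}. dot m (a i) p = \<beta> i})"
  have "F p0" using p0 by (simp add: F_def)
  moreover have cb: "card (T p) < Suc N" for p
    using card_mono[of "{..<N}" "T p"] unfolding T_def by fastforce
  ultimately obtain p where p: "F p" and mx: "\<And>q. F q \<Longrightarrow> card (T q) \<le> card (T p)"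
    using ex_has_greatest_nat[of F p0 "\<lambda>p. card (T p)" "Suc N"] by blast
  have impr: False
    if v: "\<forall>i<N. dot m (a i) p = \<beta> i \<longrightarrow> dot m (a i) v = 0" and bv: "dot m b v \<le> 0"
      and neg: "\<exists>i<N. dot m (a i) v < 0" for v
  proof -
    define S where "S = {i\<in>{..<N}. dot m (a i) v < 0}"
    define r where "r = (\<lambda>i. (dot m (a i) p - \<beta> i) / (- dot m (a i) v))"
    have S: "finite S" "S \<noteq> {}" using neg by (auto simp: S_def)
    \<comment> \<open>Ratio test: the longest step that respects all constraints. It is positive
      since a constraint decreasing along \<open>v\<close> cannot be tight at \<open>p\<close>, and
      the minimising index becomes tight.\<close>
    define t where "t = Min (r ` S)"
    obtain k where k: "k \<in> S" "t = r k" using Min_in[of "r ` S"] S unfolding t_def by blast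
    have rpos: "r i > 0" if "i \<in> S" for i
    proof -
      have "dot m (a i) p > \<beta> i" using that v p unfolding S_def F_def by force
      thus ?thesis using that by (auto simp: r_def S_def divide_pos_neg intro!: divide_pos_pos)
    qed
    hence t: "t > 0" using k by simp
    define q where "q = (\<lambda>j. p j + t * v j)"
    have dq: "dot m u q = dot m u p + t * dot m u v" for u unfolding q_def by (rule dot_add_right)
    have "F q" unfolding F_def
    proof (intro conjI allI impI)
      fix i assume i: "i < N"
      show "\<beta> i \<le> dot m (a i) q"
      proof (cases "i \<in> S")
        case True
        have "t \<le> r i" unfolding t_def using S True by simp
        thus ?thesis using True unfolding dq r_def S_def by (simp add: field_simps)
      next
        case False
        hence "0 \<le> t * dot m (a i) v" using t i by (auto simp: S_def)
        moreover have "\<beta> i \<le> dot m (a i) p" using p i by (auto simp: F_def)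
        ultimately show ?thesis unfolding dq by linarith
      qed
    next
      have "t * dot m b v \<le> 0" using t bv by (simp add: mult_nonneg_nonpos)
      thus "dot m b q \<le> dot m b p0" using p unfolding dq F_def by linarith
    qed
    moreover have "T p \<subset> T q"
    proof
      show "T p \<subseteq> T q" using v by (auto simp: T_def dq)
      have "k \<in> T q" using k by (auto simp: T_def dq S_def r_def)
      moreover have "k \<notin> T p" using k rpos[of k] by (auto simp: T_def r_def)
      ultimately show "T p \<noteq> T q" by blast
    qed
    moreover have "finite (T q)" by (simp add: T_def)
    ultimately show False using mx[of q] psubset_card_mono[of "T q" "T p"] by simp
  qed
  have "\<forall>j<m. v j = 0" if v: "\<forall>i<N. dot m (a i) p = \<beta> i \<longrightarrow> dot m (a i) v = 0" for v
  proof (rule ccontr)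
    assume nz: "\<not> (\<forall>j<m. v j = 0)"
    define w where "w = (\<lambda>j. - v j)"
    have dw: "dot m u w = - dot m u v" for u unfolding w_def by (rule dot_uminus_right)
    have w: "\<forall>i<N. dot m (a i) p = \<beta> i \<longrightarrow> dot m (a i) w = 0" using v by (simp add: dw)
    have dec: False if H: "\<forall>i<N. dot m (a i) p = \<beta> i \<longrightarrow> dot m (a i) u = 0" "dot m b u < 0" for u
    proof -
      have "\<exists>i<N. dot m (a i) u < 0"
      proof (rule ccontr)
        assume C: "\<not> ?thesis"
        \<comment> \<open>A step this long would push the objective below \<open>lo\<close>.\<close>
        define s where "s = (\<bar>lo - dot m b p\<bar> + 1) / (- dot m b u)"
        have s: "s \<ge> 0" using H(2) unfolding s_def by (intro divide_nonneg_nonneg) auto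
        have "lo \<le> dot m b (\<lambda>j. p j + s * u j)"
        proof (rule lb, intro allI impI)
          fix i assume i: "i < N"
          hence "0 \<le> dot m (a i) u" using C by (meson not_less)
          hence "0 \<le> s * dot m (a i) u" using s by simp
          thus "\<beta> i \<le> dot m (a i) (\<lambda>j. p j + s * u j)"
            unfolding dot_add_right using p i unfolding F_def by force
        qed
        moreover have "s * dot m b u = - (\<bar>lo - dot m b p\<bar> + 1)" using H(2) by (simp add: s_def)
        ultimately show False unfolding dot_add_right by linarith
      qed
      thus False using impr[of u] H by force
    qed
    show False
    \<comment> \<open>With a constant objective both \<open>v\<close> and \<open>- v\<close> are
      admissible, and the sign is chosen so that some constraint decreases. Otherwise one of the two
      strictly lowers the objective.\<close>
    proof (cases "dot m b v = 0")
      case True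
      obtain i where i: "i < N" "dot m (a i) v \<noteq> 0" using pointed nz by blast
      show False
      proof (cases "dot m (a i) v < 0")
        case t: True thus ?thesis using impr[of v] v True i by force
      next
        case False
        hence "dot m (a i) w < 0" using i by (simp add: dw)
        thus ?thesis using impr[of w] w True i by (force simp: dw)
      qed
    next
      case False
      thus ?thesis using dec[OF v] dec[OF w] by (force simp: dw)
    qed
  qed
  with p show ?thesis unfolding F_def by blast
qed

section \<open>Regular square subsystems and Cramer's rule\<close>

lemma mult_mat_vec_dot:
  "i < m \<Longrightarrow> (mat m m (\<lambda>(i, j). r i j) *\<^sub>v vec m x) $ i = dot m (r i) x"
  by (simp add: scalar_prod_def dot_def lessThan_atLeast0)

lemma mat_det_zero_iff:
  fixes r :: "nat \<Rightarrow> nat \<Rightarrow> real"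
  shows "det (mat m m (\<lambda>(i, j). r i j)) = 0 \<longleftrightarrow> (\<exists>v. (\<forall>i<m. dot m (r i) v = 0) \<and> (\<exists>j<m. v j \<noteq> 0))"
proof -
  have "det (mat m m (\<lambda>(i, j). r i j)) = 0 \<longleftrightarrow>
      (\<exists>v. v \<in> carrier_vec m \<and> v \<noteq> 0\<^sub>v m \<and> mat m m (\<lambda>(i, j). r i j) *\<^sub>v v = 0\<^sub>v m)"
    by (rule det_0_iff_vec_prod_zero) simp
  also have "\<dots> \<longleftrightarrow> (\<exists>v. (\<forall>i<m. dot m (r i) v = 0) \<and> (\<exists>j<m. v j \<noteq> 0))"
  proof safe
    fix v :: "real vec" assume v: "v \<in> carrier_vec m" "v \<noteq> 0\<^sub>v m" "mat m m (\<lambda>(i, j). r i j) *\<^sub>v v = 0\<^sub>v m"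
    have e: "vec m (\<lambda>i. v $ i) = v" using v(1) by auto
    have "\<forall>i<m. dot m (r i) (\<lambda>i. v $ i) = 0"
      using v(3) mult_mat_vec_dot[where x = "\<lambda>i. v $ i", of _ m r] unfolding e by auto
    moreover have "\<exists>j<m. v $ j \<noteq> 0" using v(1,2) by (metis carrier_vecD eq_vecI index_zero_vec)
    ultimately show "\<exists>v. (\<forall>i<m. dot m (r i) v = 0) \<and> (\<exists>j<m. v j \<noteq> 0)" by blast
  next
    fix v j assume v: "\<forall>i<m. dot m (r i) v = 0" "j < m" "v j \<noteq> 0"
    show "\<exists>v. v \<in> carrier_vec m \<and> v \<noteq> 0\<^sub>v m \<and> mat m m (\<lambda>(i, j). r i j) *\<^sub>v v = 0\<^sub>v m"
    proof (intro exI conjI)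
      show "vec m v \<noteq> 0\<^sub>v m" using v(2,3) by (metis index_vec index_zero_vec(1))
      show "mat m m (\<lambda>(i, j). r i j) *\<^sub>v vec m v = 0\<^sub>v m"
        using v(1) mult_mat_vec_dot[where x = v, of _ m r] by (intro eq_vecI) auto
    qed simp
  qed
  finally show ?thesis .
qed

text \<open>Starting from the identity matrix, rows are exchanged for vectors \<open>a k\<close> one at a time: if \<open>M v = e\<^sub>k\<close>,
  row \<open>k\<close> may be replaced by any vector not orthogonal to \<open>v\<close>.\<close>

lemma regular_row_selection:
  fixes a :: "nat \<Rightarrow> nat \<Rightarrow> real"
  assumes ker: "\<And>v. (\<forall>i\<in>T. dot m (a i) v = 0) \<Longrightarrow> \<forall>j<m. v j = 0"
  shows "\<exists>r. (\<forall>k<m. r k \<in> T) \<and> det (mat m m (\<lambda>(k, j). a (r k) j)) \<noteq> 0"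
proof -
  have "\<exists>R. det (mat m m (\<lambda>(k, j). R k j)) \<noteq> 0 \<and> (\<forall>k<K. R k \<in> a ` T)" if "K \<le> m" for K
    using that
  proof (induction K)
    case 0
    have "det (mat m m (\<lambda>(k, j). if j = k then 1 else (0::real))) \<noteq> 0"
      unfolding mat_det_zero_iff[where r = "\<lambda>k j. if j = k then 1 else 0"] using dot_unit by metis
    thus ?case by auto
  next
    case (Suc K)
    then obtain R where R: "det (mat m m (\<lambda>(k, j). R k j)) \<noteq> 0" "\<forall>k<K. R k \<in> a ` T" by auto
    have K: "K < m" using Suc by simp
    let ?M = "mat m m (\<lambda>(k, j). R k j)"
    \<comment> \<open>Column \<open>K\<close> of the adjugate is orthogonal to all rows of the
      matrix but row \<open>K\<close>, where the product is the determinant.\<close>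
    define x where "x = adj_mat ?M *\<^sub>v unit_vec m K"
    have cM: "?M \<in> carrier_mat m m" by simp
    have cA: "adj_mat ?M \<in> carrier_mat m m" using adj_mat(1)[OF cM] .
    have "?M *\<^sub>v x = (?M * adj_mat ?M) *\<^sub>v unit_vec m K"
      unfolding x_def using assoc_mult_mat_vec[OF cM cA, of "unit_vec m K"] by simp
    also have "\<dots> = det ?M \<cdot>\<^sub>v unit_vec m K"
      unfolding adj_mat(2)[OF cM]
      by (intro eq_vecI) (auto simp: smult_mat_def scalar_prod_def unit_vec_def sum.remove[of _ K] K)
    finally have Mx: "?M *\<^sub>v x = det ?M \<cdot>\<^sub>v unit_vec m K" .
    define v where "v = (\<lambda>j. x $ j)"
    have x: "vec m v = x" unfolding v_def x_def using cA by auto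
    have dv: "dot m (R k) v = (if k = K then det ?M else 0)" if "k < m" for k
    proof -
      have "dot m (R k) v = (?M *\<^sub>v x) $ k" using mult_mat_vec_dot[OF that, of R v] x by simp
      thus ?thesis unfolding Mx using that K by (auto simp: unit_vec_def)
    qed
    have "\<not> (\<forall>j<m. v j = 0)"
    proof
      assume "\<forall>j<m. v j = 0"
      hence "dot m (R K) v = 0" by (simp add: dot_def)
      thus False using dv[OF K] R(1) by simp
    qed
    then obtain i where i: "i \<in> T" "dot m (a i) v \<noteq> 0" using ker by blast
    define R' where "R' = R(K := a i)"
    have "det (mat m m (\<lambda>(k, j). R' k j)) \<noteq> 0"
    proof
      assume "det (mat m m (\<lambda>(k, j). R' k j)) = 0"
      then obtain w j where w: "\<forall>k<m. dot m (R' k) w = 0" "j < m" "w j \<noteq> 0"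
        unfolding mat_det_zero_iff by blast
      \<comment> \<open>A kernel vector \<open>w\<close> of the new matrix is corrected by a
        multiple of \<open>v\<close> so that it is orthogonal to the old row \<open>K\<close> too.
        Regularity of the old matrix makes \<open>w\<close> a multiple of \<open>v\<close>, and the
        new row \<open>a i\<close> makes that multiple zero.\<close>
      define c where "c = dot m (R K) w / det ?M"
      define u where "u = (\<lambda>j. w j + (- c) * v j)"
      have u: "\<forall>k<m. dot m (R k) u = 0"
      proof (intro allI impI)
        fix k assume k: "k < m"
        show "dot m (R k) u = 0"
        proof (cases "k = K")
          case True thus ?thesis unfolding u_def dot_add_right dv[OF k] using R(1) by (simp add: c_def)
        next
          case False
          hence "dot m (R k) w = 0" using w(1) k by (auto simp: R'_def)
          thus ?thesis unfolding u_def dot_add_right dv[OF k] using False by simp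
        qed
      qed
      have u0: "\<forall>j<m. u j = 0" using R(1) u unfolding mat_det_zero_iff by blast
      hence wv: "\<forall>j<m. w j = c * v j" by (simp add: u_def)
      have "dot m (a i) w = c * dot m (a i) v"
        unfolding dot_def sum_distrib_left by (rule sum.cong) (auto simp: wv)
      moreover have "dot m (a i) w = 0" using w(1) K by (auto simp: R'_def)
      ultimately have "c = 0" using i(2) by simp
      thus False using wv w(2,3) by simp
    qed
    moreover have "\<forall>k<Suc K. R' k \<in> a ` T" using R(2) i by (auto simp: R'_def less_Suc_eq)
    ultimately show ?case by blast
  qed
  from this[of m] obtain R where R: "det (mat m m (\<lambda>(k, j). R k j)) \<noteq> 0" "\<forall>k<m. R k \<in> a ` T" by auto
  hence "\<forall>k\<in>{..<m}. \<exists>i. i \<in> T \<and> R k = a i" by blast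
  from bchoice[OF this] obtain r where r: "\<forall>k<m. r k \<in> T \<and> R k = a (r k)" by auto
  have "mat m m (\<lambda>(k, j). R k j) = mat m m (\<lambda>(k, j). a (r k) j)"
    using r by (intro eq_matI) auto
  with R(1) r show ?thesis by (intro exI[of _ r]) auto
qed

lemma cramer_dot:
  fixes r :: "nat \<Rightarrow> nat \<Rightarrow> real"
  assumes "\<And>i. i < m \<Longrightarrow> dot m (r i) x = c i" "k < m"
  shows "det (mat m m (\<lambda>(i, j). if j = k then c i else r i j)) = x k * det (mat m m (\<lambda>(i, j). r i j))"
proof -
  let ?A = "mat m m (\<lambda>(i, j). r i j)"
  have "replace_col ?A (?A *\<^sub>v vec m x) k = mat m m (\<lambda>(i, j). if j = k then c i else r i j)"
    by (rule eq_matI) (auto simp: replace_col_def mult_mat_vec_dot assms(1) simp del: index_mult_mat_vec)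
  thus ?thesis using cramer_lemma_mat[of ?A m "vec m x" k] assms(2) by simp
qed

section \<open>Candidate solutions from integer data\<close>

lemma of_int_dot: "of_int (dot m u v) = dot m (\<lambda>j. of_int (u j)) (\<lambda>j. of_int (v j))"
  by (simp add: dot_def)

lemma dot_mono_right:
  fixes u :: "nat \<Rightarrow> real"
  assumes "\<And>i. i < n \<Longrightarrow> u i * v i \<le> u' i * v' i"
  shows "dot n u v \<le> dot n u' v'"
  unfolding dot_def by (rule sum_mono) (use assms in auto)

lemma of_int_det: "real_of_int (det A) = det (map_mat real_of_int A)"
  by simp

text \<open>All data are integers, scaled by the common denominator \<open>D\<close>.  The unit vectors are appended as
  further columns \<open>a (n + j)\<close> with zero costs, so that \<open>p \<ge> 0\<close> becomes one of the constraints
  \<open>a i \<cdot> p \<ge> 0\<close>.  A candidate \<open>f\<close> is the point \<open>p\<close> with \<open>a (f k) \<cdot> p = D * f (m + k)\<close> for \<open>k < m\<close>,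
  represented as \<open>nm f / den f\<close>; the denominator is the square of the determinant, which makes it nonnegative.\<close>

locale scaled_data =
  fixes m n :: nat and a :: "nat \<Rightarrow> nat \<Rightarrow> int" and c l b :: "nat \<Rightarrow> int" and D :: int
  assumes D_pos: "D > 0"
    and c_ext: "\<And>i. n \<le> i \<Longrightarrow> i < n + m \<Longrightarrow> c i = 0"
    and l_ext: "\<And>i. n \<le> i \<Longrightarrow> i < n + m \<Longrightarrow> l i = 0"
    and a_ext: "\<And>i j. i < m \<Longrightarrow> j < m \<Longrightarrow> a (n + i) j = (if j = i then D else 0)"
begin

definition cd :: "(nat \<Rightarrow> nat) \<Rightarrow> int" where
  "cd f = det (mat m m (\<lambda>(k, j). a (f k) j))"

definition cnum :: "(nat \<Rightarrow> nat) \<Rightarrow> nat \<Rightarrow> int" where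
  "cnum f j0 = det (mat m m (\<lambda>(k, j). if j = j0 then D * int (f (m + k)) else a (f k) j))"

definition den :: "(nat \<Rightarrow> nat) \<Rightarrow> int" where "den f = cd f * cd f"
definition nm :: "(nat \<Rightarrow> nat) \<Rightarrow> nat \<Rightarrow> int" where "nm f j = cd f * cnum f j"
definition lhs :: "(nat \<Rightarrow> nat) \<Rightarrow> nat \<Rightarrow> int" where "lhs f i = dot m (a i) (nm f)"

text \<open>The first condition is \<open>(A\<^sup>T p) i < 1\<close> cleared of denominators, as
  both \<open>a\<close> and the right-hand sides carry the factor \<open>D\<close>. When postponing
  is allowed, the cheaper of the two fixed costs decides.\<close>

definition buy :: "(nat \<Rightarrow> nat) \<Rightarrow> nat \<Rightarrow> bool" where
  "buy f i \<longleftrightarrow> lhs f i < D * den f \<or> c i \<le> l i"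

text \<open>The upper limit \<open>k\<close> is a parameter so that partial sums can serve as the
  loop invariant of the evaluation. The value \<open>pval f k / den f\<close> carries the factor
  \<open>D\<close> of the data.\<close>

definition pval :: "(nat \<Rightarrow> nat) \<Rightarrow> nat \<Rightarrow> int" where
  "pval f k = dot m b (nm f) + (\<Sum>i<k. (if buy f i then c i else l i) * den f)"

text \<open>For \<open>i < n\<close> this is the dual constraint of a bought item, with right-hand
  side 0; for the appended columns it is \<open>p \<ge> 0\<close>. The stronger bound for postponed
  items is enforced by \<open>buy\<close>.\<close>

definition feas :: "(nat \<Rightarrow> nat) \<Rightarrow> bool" where
  "feas f \<longleftrightarrow> den f > 0 \<and> (\<forall>i<n + m. lhs f i \<ge> 0)"

definition choices :: "nat \<Rightarrow> nat" where
  "choices k = (if k < m then n + m else 2)"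

text \<open>The entries from \<open>k\<close> on are frozen at \<open>r\<close>: these are the
  values of the outer loop counters while the inner \<open>k\<close> loops run.\<close>

definition box :: "nat \<Rightarrow> (nat \<Rightarrow> nat) \<Rightarrow> (nat \<Rightarrow> nat) set" where
  "box k r = {f. (\<forall>i<k. f i < choices i) \<and> (\<forall>i\<ge>k. f i = r i)}"

abbreviation "val f \<equiv> pval f (n + m)"

definition scenarios :: "(nat \<Rightarrow> real) set" where
  "scenarios = {d. (\<forall>i<n. d i \<ge> 0) \<and> (\<forall>j<m. dot n (\<lambda>i. of_int (a i j)) d \<le> of_int (b j))}"

definition fixed_cost :: "(nat \<Rightarrow> bool) \<Rightarrow> real" where
  "fixed_cost x = (\<Sum>i<n. if x i then of_int (c i) else of_int (l i))"

lemma dot_ext_col: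
  assumes "j < m" shows "dot m (\<lambda>k. real_of_int (a (n + j) k)) v = of_int D * v j"
proof -
  have "dot m (\<lambda>k. real_of_int (a (n + j) k)) v = of_int D * dot m (\<lambda>k. if k = j then 1 else 0) v"
    unfolding dot_def sum_distrib_left by (rule sum.cong) (use assms in \<open>auto simp: a_ext\<close>)
  thus ?thesis by (simp add: dot_unit[OF assms])
qed

lemma weak_duality:
  assumes "\<And>j. j < m \<Longrightarrow> p j \<ge> 0" "\<And>i. i < n \<Longrightarrow> y i \<le> dot m (\<lambda>j. real_of_int (a i j)) p" "d \<in> scenarios"
  shows "dot n y d \<le> dot m (\<lambda>j. of_int (b j)) p"
proof -
  have "dot n y d \<le> dot n (\<lambda>i. dot m (\<lambda>j. real_of_int (a i j)) p) d"
    using assms(2,3) by (intro dot_mono_right mult_right_mono) (auto simp: scenarios_def)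
  also have "\<dots> = dot m (\<lambda>j. dot n (\<lambda>i. real_of_int (a i j)) d) p" by (rule dot_sum_swap)
  also have "\<dots> \<le> dot m (\<lambda>j. of_int (b j)) p"
    using assms(1,3) by (intro dot_mono_right mult_right_mono) (auto simp: scenarios_def)
  finally show ?thesis .
qed

lemma sum_ext_zero:
  assumes "\<And>i. n \<le> i \<Longrightarrow> i < n + m \<Longrightarrow> g i = (0::real)"
  shows "sum g {..<n + m} = sum g {..<n}"
  by (rule sum.mono_neutral_right) (use assms in auto)

lemma val_quotient:
  assumes "den f \<noteq> 0"
  shows "of_int (val f) / of_int (den f) =
    dot m (\<lambda>j. of_int (b j)) (\<lambda>j. of_int (nm f j) / of_int (den f)) + fixed_cost (buy f)"
proof -
  have "real_of_int (val f) = dot m (\<lambda>j. of_int (b j)) (\<lambda>j. of_int (nm f j)) +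
      (\<Sum>i<n + m. if buy f i then of_int (c i) else of_int (l i)) * of_int (den f)"
    unfolding pval_def of_int_add of_int_dot of_int_sum sum_distrib_right
    by (intro arg_cong2[of _ _ _ _ "(+)"] sum.cong) auto
  also have "(\<Sum>i<n + m. if buy f i then of_int (c i) else of_int (l i)) = fixed_cost (buy f)"
    unfolding fixed_cost_def by (rule sum_ext_zero) (auto simp: c_ext l_ext)
  finally show ?thesis using assms by (simp add: add_divide_distrib dot_def sum_divide_distrib)
qed

text \<open>Weak duality with \<open>p = nm f / den f\<close>: by definition of \<open>buy\<close>,
  the point \<open>p\<close> satisfies the dual constraints for the solution \<open>buy f\<close>.
  No candidate can therefore report less than the cost of its own solution.\<close>

lemma candidate_sound:
  assumes f: "feas f" and d: "d \<in> scenarios"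
  shows "fixed_cost (buy f) + of_int D * dot n (\<lambda>i. if buy f i then 0 else 1) d \<le> of_int (val f) / of_int (den f)"
proof -
  have den: "den f > 0" using f by (simp add: feas_def)
  define p where "p = (\<lambda>j. real_of_int (nm f j) / of_int (den f))"
  have lp: "dot m (\<lambda>j. real_of_int (a i j)) p = of_int (lhs f i) / of_int (den f)" for i
    unfolding lhs_def of_int_dot by (simp add: p_def dot_def sum_divide_distrib)
  have "dot n (\<lambda>i. if buy f i then 0 else of_int D) d \<le> dot m (\<lambda>j. of_int (b j)) p"
  proof (rule weak_duality[OF _ _ d])
    fix j assume j: "j < m"
    have "of_int D * p j = of_int (lhs f (n + j)) / of_int (den f)"
      using dot_ext_col[OF j, of p] lp by simp
    also have "\<dots> \<ge> 0" using f j by (simp add: feas_def)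
    finally show "p j \<ge> 0" using D_pos by (simp add: zero_le_mult_iff)
  next
    fix i assume i: "i < n"
    have "real_of_int (if buy f i then 0 else D * den f) \<le> of_int (lhs f i)"
      using f i by (subst of_int_le_iff) (auto simp: feas_def buy_def)
    thus "(if buy f i then 0 else of_int D) \<le> dot m (\<lambda>j. real_of_int (a i j)) p"
      unfolding lp using den by (auto simp: pos_le_divide_eq simp flip: of_int_mult)
  qed
  moreover have "dot n (\<lambda>i. if buy f i then 0 else of_int D) d =
      of_int D * dot n (\<lambda>i. if buy f i then 0 else 1) d"
    unfolding dot_def sum_distrib_left by (rule sum.cong) auto
  ultimately show ?thesis using val_quotient[of f] den unfolding p_def by simp
qed

text \<open>For the choice \<open>y\<close>, strong duality yields a dual point of value at most
  \<open>D * z\<close>, and a vertex that is no worse is a candidate \<open>f\<close> by Cramer's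
  rule. Passing from \<open>y\<close> to \<open>buy f\<close> cannot increase the cost, because
  \<open>buy f\<close> takes the cheaper option wherever this point allows both, and
  \<open>y\<close> is one of the allowed choices.\<close>

lemma candidate_complete:
  assumes d0: "d0 \<in> scenarios"
    and z: "\<And>d. d \<in> scenarios \<Longrightarrow> dot n (\<lambda>i. if y i then 0 else 1) d \<le> z"
  shows "\<exists>f. f \<in> box (m + m) (\<lambda>_. 0) \<and> feas f \<and>
    of_int (val f) / of_int (den f) \<le> fixed_cost y + of_int D * z"
proof -
  let ?a = "\<lambda>i j. real_of_int (a i j)" and ?b = "\<lambda>j. real_of_int (b j)" and ?D = "real_of_int D"
  define \<beta> where "\<beta> = (\<lambda>i. if i < n \<and> \<not> y i then ?D else 0)"
  have D: "?D > 0" using D_pos by simp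
  have \<beta>: "dot n \<beta> d = ?D * dot n (\<lambda>i. if y i then 0 else 1) d" for d
    unfolding dot_def sum_distrib_left by (rule sum.cong) (auto simp: \<beta>_def)
  have "\<exists>p. (\<forall>j<m. p j \<ge> 0) \<and> (\<forall>i<n. dot m (?a i) p \<ge> \<beta> i) \<and> dot m ?b p \<le> ?D * z"
    by (rule lp_dual_certificate[of n d0]) (use d0 z D in \<open>auto simp: scenarios_def \<beta>\<close>)
  then obtain p0 where p0: "\<forall>j<m. p0 j \<ge> 0" "\<forall>i<n. dot m (?a i) p0 \<ge> \<beta> i" "dot m ?b p0 \<le> ?D * z"
    by blast
  have cone: "(\<forall>i<n + m. \<beta> i \<le> dot m (?a i) p) \<longleftrightarrow> (\<forall>j<m. p j \<ge> 0) \<and> (\<forall>i<n. dot m (?a i) p \<ge> \<beta> i)" for p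
  proof (intro iffI conjI allI impI)
    fix j assume "\<forall>i<n + m. \<beta> i \<le> dot m (?a i) p" "j < m"
    hence "\<beta> (n + j) \<le> dot m (?a (n + j)) p" by simp
    thus "p j \<ge> 0" using D by (simp add: dot_ext_col[OF \<open>j < m\<close>] \<beta>_def zero_le_mult_iff)
  next
    fix i assume H: "(\<forall>j<m. p j \<ge> 0) \<and> (\<forall>i<n. dot m (?a i) p \<ge> \<beta> i)" "i < n + m"
    show "\<beta> i \<le> dot m (?a i) p"
    proof (cases "i < n")
      case False
      then obtain j where "i = n + j" "j < m" using H(2) by (metis add_less_cancel_left le_iff_add not_less)
      thus ?thesis using H D by (simp add: dot_ext_col \<beta>_def)
    qed (use H in auto)
  qed auto
  have "\<exists>p. (\<forall>i<n + m. dot m (?a i) p \<ge> \<beta> i) \<and> dot m ?b p \<le> dot m ?b p0 \<and>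
    (\<forall>v. (\<forall>i<n + m. dot m (?a i) p = \<beta> i \<longrightarrow> dot m (?a i) v = 0) \<longrightarrow> (\<forall>j<m. v j = 0))"
  proof (rule tight_point_with_trivial_kernel)
    fix v assume H: "\<forall>i<n + m. dot m (?a i) v = 0"
    show "\<forall>j<m. v j = 0"
    proof (intro allI impI)
      fix j assume j: "j < m"
      have "dot m (?a (n + j)) v = 0" using H j by simp
      thus "v j = 0" using D by (simp add: dot_ext_col[OF j])
    qed
  next
    \<comment> \<open>Weak duality against the single scenario \<open>d0\<close> bounds the dual
      objective from below.\<close>
    fix p assume "\<forall>i<n + m. \<beta> i \<le> dot m (?a i) p"
    thus "dot n \<beta> d0 \<le> dot m ?b p" unfolding cone by (intro weak_duality[OF _ _ d0]) auto
  next
    show "\<forall>i<n + m. \<beta> i \<le> dot m (?a i) p0" unfolding cone using p0 by simp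
  qed
  then obtain p where p: "\<forall>i<n + m. dot m (?a i) p \<ge> \<beta> i" "dot m ?b p \<le> dot m ?b p0"
    and ker: "\<And>v. (\<forall>i<n + m. dot m (?a i) p = \<beta> i \<longrightarrow> dot m (?a i) v = 0) \<Longrightarrow> (\<forall>j<m. v j = 0)"
    by blast
  have "\<exists>r. (\<forall>k<m. r k \<in> {i. i < n + m \<and> dot m (?a i) p = \<beta> i}) \<and> det (mat m m (\<lambda>(k, j). ?a (r k) j)) \<noteq> 0"
    by (rule regular_row_selection) (use ker in blast)
  then obtain r where r: "\<And>k. k < m \<Longrightarrow> r k < n + m" "\<And>k. k < m \<Longrightarrow> dot m (?a (r k)) p = \<beta> (r k)"
    and det: "det (mat m m (\<lambda>(k, j). ?a (r k) j)) \<noteq> 0" by blast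
  \<comment> \<open>The first \<open>m\<close> entries select the tight constraints, the next
    \<open>m\<close> tell whether their right-hand sides are \<open>D\<close> or 0, and the default
    0 places \<open>f\<close> in the box.\<close>
  define f where "f = (\<lambda>k. if k < m then r k else if k < m + m \<and> \<beta> (r (k - m)) \<noteq> 0 then 1 else 0)"
  have f1: "f k = r k" if "k < m" for k using that by (simp add: f_def)
  have f2: "?D * real (f (m + k)) = \<beta> (r k)" if "k < m" for k using that by (simp add: f_def \<beta>_def)
  have cd: "real_of_int (cd f) = det (mat m m (\<lambda>(k, j). ?a (r k) j))"
    unfolding cd_def of_int_det by (rule arg_cong[of _ _ det]) (auto intro!: eq_matI simp: f1)
  have num: "real_of_int (cnum f j) = p j * of_int (cd f)" if "j < m" for j
  proof -
    have "real_of_int (cnum f j) = det (mat m m (\<lambda>(k, j'). if j' = j then \<beta> (r k) else ?a (r k) j'))"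
      unfolding cnum_def of_int_det
      by (rule arg_cong[of _ _ det]) (auto intro!: eq_matI simp: f1 f2[symmetric])
    also have "\<dots> = p j * of_int (cd f)" unfolding cd by (rule cramer_dot) (use r that in auto)
    finally show ?thesis .
  qed
  have den: "den f > 0" using det unfolding den_def cd[symmetric] by (simp add: zero_less_mult_iff) linarith
  have nm: "real_of_int (nm f j) = p j * of_int (den f)" if "j < m" for j
    using num[OF that] by (simp add: nm_def den_def)
  have dnm: "dot m u (\<lambda>j. of_int (nm f j)) = dot m u p * of_int (den f)" for u
    unfolding dot_def sum_distrib_right by (rule sum.cong) (auto simp: nm)
  have lhs: "real_of_int (lhs f i) = dot m (?a i) p * of_int (den f)" for i
    unfolding lhs_def of_int_dot by (rule dnm)
  have feas: "feas f" unfolding feas_def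
  proof (intro conjI allI impI)
    fix i assume "i < n + m"
    moreover have "\<beta> i \<ge> 0" using D by (simp add: \<beta>_def)
    ultimately have "0 \<le> dot m (?a i) p" using p(1) by fastforce
    hence "0 \<le> real_of_int (lhs f i)" unfolding lhs using den by simp
    thus "0 \<le> lhs f i" by simp
  qed (rule den)
  have le: "(if buy f i then real_of_int (c i) else of_int (l i)) \<le> (if y i then of_int (c i) else of_int (l i))"
    if i: "i < n" for i
  proof -
    have "D * den f \<le> lhs f i" if "\<not> y i"
    proof -
      have "?D * of_int (den f) \<le> dot m (?a i) p * of_int (den f)"
        using p(1)[rule_format, of i] i that den by (intro mult_right_mono) (auto simp: \<beta>_def)
      thus ?thesis unfolding lhs[symmetric] by (metis of_int_le_iff of_int_mult)
    qed
    thus ?thesis by (auto simp: buy_def)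
  qed
  have "of_int (val f) / of_int (den f) = dot m ?b p + fixed_cost (buy f)"
  proof -
    have "dot m ?b (\<lambda>j. of_int (nm f j) / of_int (den f)) = dot m ?b p"
      unfolding dot_def by (rule sum.cong) (use den in \<open>auto simp: nm\<close>)
    thus ?thesis using val_quotient[of f] den by simp
  qed
  also have "\<dots> \<le> ?D * z + fixed_cost y"
    unfolding fixed_cost_def using p(2) p0(3) by (intro add_mono sum_mono le) auto
  finally have "of_int (val f) / of_int (den f) \<le> fixed_cost y + ?D * z" by simp
  moreover have "f \<in> box (m + m) (\<lambda>_. 0)" using r by (auto simp: f_def box_def choices_def)
  ultimately show ?thesis using feas by blast
qed

end

section \<open>Verification of programs with time bounds\<close>

lemma int_size_le_iff: "int_size z \<le> Suc B \<longleftrightarrow> \<bar>z\<bar> < 2 ^ B"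
proof -
  have "floorlog 2 (nat \<bar>z\<bar>) \<le> B \<longleftrightarrow> nat \<bar>z\<bar> < 2 ^ B"
    by (simp add: floorlog_le_iff)
  also have "\<dots> \<longleftrightarrow> \<bar>z\<bar> < 2 ^ B"
    by (simp add: nat_less_iff)
  finally show ?thesis by (simp add: int_size_def)
qed

lemma int_size_pos: "0 < int_size z"
  by (simp add: int_size_def)

definition bounded_cells :: "nat \<Rightarrow> store \<Rightarrow> bool" where
  "bounded_cells B s \<longleftrightarrow> (\<forall>a i. \<bar>s a i\<bar> < 2 ^ B)"

text \<open>\<open>vsize e * B\<close> bounds the bit length of the value of \<open>e\<close> and \<open>ecost e * B\<close> the cost of its
  evaluation if all cells have at most \<open>B\<close> bits.\<close>

fun vsize :: "aexp \<Rightarrow> nat" where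
  "vsize (Lit z) = int_size z"
| "vsize (Cell a e) = 1"
| "vsize (Plus e f) = vsize e + vsize f"
| "vsize (Minus e f) = vsize e + vsize f"
| "vsize (Times e f) = vsize e + vsize f"

fun ecost :: "aexp \<Rightarrow> nat" where
  "ecost (Lit z) = int_size z"
| "ecost (Cell a e) = ecost e + 2"
| "ecost (Plus e f) = ecost e + ecost f + vsize e + vsize f + 1"
| "ecost (Minus e f) = ecost e + ecost f + vsize e + vsize f + 1"
| "ecost (Times e f) = ecost e + ecost f + vsize e + vsize f + 1"

fun becost :: "bexp \<Rightarrow> nat" where
  "becost (Less e f) = ecost e + ecost f + 1"
| "becost (Neg b) = becost b + 1"
| "becost (Conj b c) = becost b + becost c + 1"

lemma vsize_pos: "0 < vsize e"
  by (induction e) (simp_all add: int_size_pos)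

text \<open>Equivalent to \<open>1 \<le> (2 ^ p - 1) * (2 ^ q - 1)\<close>. It lets
  \<open>vsize\<close> add up for sums and differences just as for products.\<close>

lemma power2_add_le:
  assumes "0 < p" "0 < q" shows "(2::int) ^ p + 2 ^ q \<le> 2 ^ (p + q)"
proof -
  have "(2::int) \<le> 2 ^ p" "(2::int) \<le> 2 ^ q" using assms power_increasing[of 1 _ "2::int"] by force+
  hence "1 * 1 \<le> ((2::int) ^ p - 1) * (2 ^ q - 1)" by (intro mult_mono) auto
  thus ?thesis by (simp add: power_add algebra_simps)
qed

lemma aval_bound:
  assumes "bounded_cells B s" "0 < B"
  shows "\<bar>aval e s\<bar> < 2 ^ (vsize e * B)"
proof (induction e)
  case (Lit z)
  obtain k where k: "int_size z = Suc k" using int_size_pos[of z] by (cases "int_size z") auto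
  hence "\<bar>z\<bar> < 2 ^ k" using int_size_le_iff[of z k] by simp
  also have "(2::int) ^ k \<le> 2 ^ (int_size z * B)"
    using k assms(2) by (intro power_increasing) (auto simp: Suc_leI trans_le_add2)
  finally show ?case by simp
next
  case (Cell a e)
  thus ?case using assms(1) by (simp add: bounded_cells_def)
next
  case (Plus e f)
  have "\<bar>aval (Plus e f) s\<bar> < 2 ^ (vsize e * B) + 2 ^ (vsize f * B)" using Plus by simp
  also have "\<dots> \<le> 2 ^ (vsize e * B + vsize f * B)"
    using vsize_pos assms(2) by (intro power2_add_le) simp_all
  finally show ?case by (simp add: algebra_simps)
next
  case (Minus e f)
  have "\<bar>aval (Minus e f) s\<bar> < 2 ^ (vsize e * B) + 2 ^ (vsize f * B)" using Minus by simp
  also have "\<dots> \<le> 2 ^ (vsize e * B + vsize f * B)"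
    using vsize_pos assms(2) by (intro power2_add_le) simp_all
  finally show ?case by (simp add: algebra_simps)
next
  case (Times e f)
  have "\<bar>aval (Times e f) s\<bar> < 2 ^ (vsize e * B) * 2 ^ (vsize f * B)"
    using Times by (simp add: abs_mult mult_strict_mono)
  thus ?case by (simp add: algebra_simps power_add)
qed

lemma int_size_aval:
  assumes "bounded_cells B s" "0 < B"
  shows "int_size (aval e s) \<le> Suc (vsize e * B)"
  using aval_bound[OF assms] by (simp add: int_size_le_iff)

lemma acost_bound:
  assumes "bounded_cells B s" "0 < B"
  shows "acost e s \<le> ecost e * B"
proof (induction e)
  case (Lit z)
  thus ?case using assms(2) by simp
next
  case (Cell a e)
  have "int_size (aval (Cell a e) s) \<le> Suc B" using int_size_aval[OF assms, of "Cell a e"] by simp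
  with Cell show ?case using assms(2) by (simp add: algebra_simps)
next
  case (Plus e f)
  show ?case using Plus int_size_aval[OF assms, of "Plus e f"] assms(2) by (simp add: algebra_simps)
next
  case (Minus e f)
  show ?case using Minus int_size_aval[OF assms, of "Minus e f"] assms(2) by (simp add: algebra_simps)
next
  case (Times e f)
  show ?case using Times int_size_aval[OF assms, of "Times e f"] assms(2) by (simp add: algebra_simps)
qed

lemma bcost_bound:
  assumes "bounded_cells B s" "0 < B"
  shows "bcost b s \<le> becost b * B"
proof (induction b)
  case (Less e f)
  show ?case using acost_bound[OF assms, of e] acost_bound[OF assms, of f] assms(2)
    by (simp add: algebra_simps)
qed (use assms(2) in \<open>simp_all add: algebra_simps\<close>)

text \<open>An a priori time bound for programs all of whose loops make at most \<open>L\<close> iterations.\<close>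

fun ccost :: "com \<Rightarrow> nat \<Rightarrow> nat \<Rightarrow> nat" where
  "ccost Skip L B = 1"
| "ccost (Assign a i e) L B = (ecost i + ecost e) * B + 1"
| "ccost (Seq c d) L B = ccost c L B + ccost d L B + 1"
| "ccost (Cond b c d) L B = becost b * B + ccost c L B + ccost d L B + 1"
| "ccost (Loop b c) L B = (L + 1) * (becost b * B + ccost c L B + 1)"

text \<open>The degree grows with the loop nesting of \<open>c\<close>, but \<open>c\<close> is
  fixed before the input. The word length is already substituted as a polynomial \<open>q\<close> in
  the number of iterations.\<close>

lemma ccost_poly: "\<exists>p :: nat poly. \<forall>L. ccost c L (poly q L) = poly p L"
proof (induction c)
  case Skip
  show ?case by (rule exI[of _ 1]) simp
next
  case (Assign a i e)
  show ?case by (rule exI[of _ "[:ecost i + ecost e:] * q + 1"]) simp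
next
  case (Seq c d)
  then obtain p r :: "nat poly" where "\<forall>L. ccost c L (poly q L) = poly p L" "\<forall>L. ccost d L (poly q L) = poly r L"
    by blast
  thus ?case by (intro exI[of _ "p + r + 1"]) simp
next
  case (Cond b c d)
  then obtain p r :: "nat poly" where "\<forall>L. ccost c L (poly q L) = poly p L" "\<forall>L. ccost d L (poly q L) = poly r L"
    by blast
  thus ?case by (intro exI[of _ "[:becost b:] * q + p + r + 1"]) simp
next
  case (Loop b c)
  then obtain p :: "nat poly" where "\<forall>L. ccost c L (poly q L) = poly p L" by blast
  thus ?case by (intro exI[of _ "[:1, 1:] * ([:becost b:] * q + p + 1)"]) (simp add: algebra_simps)
qed

section \<open>Total correctness with frames and time bounds\<close>

fun mods :: "com \<Rightarrow> nat set" where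
  "mods Skip = {}"
| "mods (Assign a i e) = {a}"
| "mods (Seq c d) = mods c \<union> mods d"
| "mods (Cond b c d) = mods c \<union> mods d"
| "mods (Loop b c) = mods c"

lemma exec_mods: "exec c s t s' \<Longrightarrow> a \<notin> mods c \<Longrightarrow> s' a = s a"
  by (induction rule: exec.induct) auto

text \<open>Boundedness of the cells is an implicit pre- and postcondition, so assertions need not
  carry it. Since \<open>ccost\<close> depends only on the program text, \<open>L\<close> and
  \<open>B\<close>, verification reduces to iteration counts and sizes of assigned values.\<close>

definition wp :: "nat \<Rightarrow> nat \<Rightarrow> com \<Rightarrow> store \<Rightarrow> (store \<Rightarrow> bool) \<Rightarrow> bool" where
  "wp L B c s Q \<longleftrightarrow> (bounded_cells B s \<longrightarrow>
     (\<exists>t s'. exec c s t s' \<and> t \<le> ccost c L B \<and> bounded_cells B s' \<and> Q s'))"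

text \<open>Consequence rule and frame rule in one: arrays that the program never assigns are known
  to be unchanged when the new postcondition is proved.\<close>

lemma wp_conseq:
  assumes "wp L B c s Q"
    and "\<And>s'. bounded_cells B s' \<Longrightarrow> (\<And>a. a \<notin> mods c \<Longrightarrow> s' a = s a) \<Longrightarrow> Q s' \<Longrightarrow> R s'"
  shows "wp L B c s R"
  using assms exec_mods unfolding wp_def by metis

lemma wp_bounded:
  assumes "bounded_cells B s \<Longrightarrow> wp L B c s Q"
  shows "wp L B c s Q"
  using assms unfolding wp_def by blast

lemma wp_Skip: "Q s \<Longrightarrow> wp L B Skip s Q"
  unfolding wp_def using exec.Skip by fastforce

lemma wp_Assign:
  assumes "0 < B" "\<bar>aval e s\<bar> < 2 ^ B" "Q (s(a := (s a)(aval i s := aval e s)))"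
  shows "wp L B (Assign a i e) s Q"
  unfolding wp_def
proof (intro impI exI conjI)
  assume b: "bounded_cells B s"
  show "exec (Assign a i e) s (acost i s + acost e s + 1) (s(a := (s a)(aval i s := aval e s)))"
    by (rule exec.Assign)
  show "acost i s + acost e s + 1 \<le> ccost (Assign a i e) L B"
    using acost_bound[OF b assms(1), of i] acost_bound[OF b assms(1), of e] by (simp add: algebra_simps)
  show "bounded_cells B (s(a := (s a)(aval i s := aval e s)))"
    using b assms(2) by (auto simp: bounded_cells_def)
qed (rule assms(3))

lemma wp_Seq:
  assumes "wp L B c s (\<lambda>s'. wp L B d s' Q)"
  shows "wp L B (Seq c d) s Q"
  unfolding wp_def
proof
  assume "bounded_cells B s"
  then obtain t s' where 1: "exec c s t s'" "t \<le> ccost c L B" "bounded_cells B s'" "wp L B d s' Q"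
    using assms unfolding wp_def by blast
  then obtain t' s'' where 2: "exec d s' t' s''" "t' \<le> ccost d L B" "bounded_cells B s''" "Q s''"
    unfolding wp_def by blast
  show "\<exists>t s'. exec (Seq c d) s t s' \<and> t \<le> ccost (Seq c d) L B \<and> bounded_cells B s' \<and> Q s'"
    using exec.Seq[OF 1(1) 2(1)] 1 2 by fastforce
qed

lemma wp_Cond:
  assumes "0 < B" "bval b s \<Longrightarrow> wp L B c s Q" "\<not> bval b s \<Longrightarrow> wp L B d s Q"
  shows "wp L B (Cond b c d) s Q"
  unfolding wp_def
proof
  assume bd: "bounded_cells B s"
  note bc = bcost_bound[OF bd assms(1), of b]
  show "\<exists>t s'. exec (Cond b c d) s t s' \<and> t \<le> ccost (Cond b c d) L B \<and> bounded_cells B s' \<and> Q s'"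
  proof (cases "bval b s")
    case True
    then obtain t s' where 1: "exec c s t s'" "t \<le> ccost c L B" "bounded_cells B s'" "Q s'"
      using assms(2) bd unfolding wp_def by blast
    thus ?thesis using exec.CondTrue[OF True 1(1), of d] bc by fastforce
  next
    case False
    then obtain t s' where 1: "exec d s t s'" "t \<le> ccost d L B" "bounded_cells B s'" "Q s'"
      using assms(3) bd unfolding wp_def by blast
    thus ?thesis using exec.CondFalse[OF False 1(1), of c] bc by fastforce
  qed
qed

lemma wp_Loop_aux:
  assumes B: "0 < B"
    and step: "\<And>s. I s \<Longrightarrow> bval b s \<Longrightarrow> wp L B c s (\<lambda>s'. I s' \<and> v s' < v s)"
  shows "I s \<Longrightarrow> bounded_cells B s \<Longrightarrow>
    \<exists>t s'. exec (Loop b c) s t s' \<and> t \<le> (v s + 1) * (becost b * B + ccost c L B + 1) \<and>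
      bounded_cells B s' \<and> I s' \<and> \<not> bval b s'"
proof (induction "v s" arbitrary: s rule: less_induct)
  case less
  note bc = bcost_bound[OF less.prems(2) B, of b]
  show ?case
  proof (cases "bval b s")
    case False
    have "bcost b s + 1 \<le> (v s + 1) * (becost b * B + ccost c L B + 1)" using bc by simp
    thus ?thesis using exec.LoopFalse[OF False] False less.prems by blast
  next
    case True
    obtain t s' where 1: "exec c s t s'" "t \<le> ccost c L B" "bounded_cells B s'" "I s'" "v s' < v s"
      using step[OF less.prems(1) True] less.prems(2) unfolding wp_def by blast
    obtain t' s'' where 2: "exec (Loop b c) s' t' s''"
        "t' \<le> (v s' + 1) * (becost b * B + ccost c L B + 1)" "bounded_cells B s''" "I s''" "\<not> bval b s''"
      using less.hyps[OF 1(5,4,3)] by blast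
    have "(v s' + 1) * (becost b * B + ccost c L B + 1) \<le> v s * (becost b * B + ccost c L B + 1)"
      using 1(5) by (intro mult_le_mono1) simp
    hence "bcost b s + t + t' + 1 \<le> (v s + 1) * (becost b * B + ccost c L B + 1)"
      using bc 1(2) 2(2) by simp
    thus ?thesis using exec.LoopTrue[OF True 1(1) 2(1)] 2 by blast
  qed
qed

lemma wp_Loop:
  assumes "0 < B" "\<And>s. I s \<Longrightarrow> bval b s \<Longrightarrow> wp L B c s (\<lambda>s'. I s' \<and> v s' < v s)" "I s" "v s \<le> L"
    and "\<And>s'. I s' \<Longrightarrow> \<not> bval b s' \<Longrightarrow> Q s'"
  shows "wp L B (Loop b c) s Q"
  unfolding wp_def
proof
  assume "bounded_cells B s"
  from wp_Loop_aux[where I = I and v = v, OF assms(1,2,3) this]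
  obtain t s' where 1: "exec (Loop b c) s t s'" "t \<le> (v s + 1) * (becost b * B + ccost c L B + 1)"
      "bounded_cells B s'" "I s'" "\<not> bval b s'" by blast
  have "(v s + 1) * (becost b * B + ccost c L B + 1) \<le> ccost (Loop b c) L B"
    unfolding ccost.simps using assms(4) by (intro mult_le_mono1) simp
  thus "\<exists>t s'. exec (Loop b c) s t s' \<and> t \<le> ccost (Loop b c) L B \<and> bounded_cells B s' \<and> Q s'"
    using 1 assms(5) by (meson le_trans)
qed

definition For :: "nat \<Rightarrow> aexp \<Rightarrow> com \<Rightarrow> com" where
  "For x u c = Seq (Assign x (Lit 0) (Lit 0)) (Loop (Less (Cell x (Lit 0)) u)
     (Seq c (Assign x (Lit 0) (Plus (Cell x (Lit 0)) (Lit 1)))))"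

lemma mods_For: "mods (For x u c) = insert x (mods c)"
  by (simp add: For_def)

text \<open>\<open>I k\<close> describes the state after \<open>k\<close> rounds and may not depend
  on the counter array (\<open>indep\<close>), so incrementing the counter preserves it. The bound
  \<open>u\<close> is evaluated anew in each round, hence its value must be determined by arrays
  outside the loop.\<close>

lemma wp_For:
  assumes B: "0 < B" and L: "N \<le> L" "int N < 2 ^ B" and x: "x \<notin> mods c"
    and u: "\<And>s'. (\<And>a. a \<notin> insert x (mods c) \<Longrightarrow> s' a = s a) \<Longrightarrow> aval u s' = int N"
    and indep: "\<And>k s' y. I k s' \<Longrightarrow> I k (s'(x := y))"
    and init: "I 0 s"
    and step: "\<And>k s'. k < N \<Longrightarrow> I k s' \<Longrightarrow> s' x 0 = int k \<Longrightarrow> (\<And>a. a \<notin> insert x (mods c) \<Longrightarrow> s' a = s a)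
      \<Longrightarrow> wp L B c s' (I (Suc k))"
    and final: "\<And>s'. I N s' \<Longrightarrow> (\<And>a. a \<notin> insert x (mods c) \<Longrightarrow> s' a = s a) \<Longrightarrow> Q s'"
  shows "wp L B (For x u c) s Q"
proof -
  define J where "J = (\<lambda>s'. \<exists>k\<le>N. s' x 0 = int k \<and> I k s' \<and> (\<forall>a. a \<notin> insert x (mods c) \<longrightarrow> s' a = s a))"
  have "wp L B (Loop (Less (Cell x (Lit 0)) u) (Seq c (Assign x (Lit 0) (Plus (Cell x (Lit 0)) (Lit 1)))))
      (s(x := (s x)(0 := 0))) Q"
  proof (rule wp_Loop[where I = J and v = "\<lambda>s'. N - nat (s' x 0)"])
    fix s' assume J: "J s'" and b: "bval (Less (Cell x (Lit 0)) u) s'"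
    then obtain k where k: "s' x 0 = int k" "I k s'" "\<forall>a. a \<notin> insert x (mods c) \<longrightarrow> s' a = s a"
      by (auto simp: J_def)
    have un: "aval u s' = int N" by (rule u) (use k in blast)
    have kN: "k < N" using b k un by simp
    show "wp L B (Seq c (Assign x (Lit 0) (Plus (Cell x (Lit 0)) (Lit 1)))) s'
        (\<lambda>s''. J s'' \<and> N - nat (s'' x 0) < N - nat (s' x 0))"
    proof (rule wp_Seq, rule wp_conseq[OF step[OF kN k(2,1)]])
      fix s'' assume fr: "\<And>a. a \<notin> mods c \<Longrightarrow> s'' a = s' a" and I: "I (Suc k) s''"
      have sx: "s'' x 0 = int k" using fr[OF x] k by simp
      show "wp L B (Assign x (Lit 0) (Plus (Cell x (Lit 0)) (Lit 1))) s''
        (\<lambda>s''. J s'' \<and> N - nat (s'' x 0) < N - nat (s' x 0))"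
      proof (rule wp_Assign[OF B], goal_cases)
        case 1
        have "int k + 1 < 2 ^ B" using L kN by linarith
        thus ?case using sx by simp
      next
        case 2
        show ?case unfolding J_def
        proof (intro conjI exI[of _ "Suc k"])
          show "I (Suc k) (s''(x := (s'' x)(aval (Lit 0) s'' := aval (Plus (Cell x (Lit 0)) (Lit 1)) s'')))"
            by (rule indep[OF I])
        qed (use sx kN k fr in auto)
      qed
    qed (use k in blast)
  next
    show "J (s(x := (s x)(0 := 0)))" unfolding J_def
      by (intro exI[of _ 0]) (use init indep in auto)
  next
    fix s' assume J: "J s'" and b: "\<not> bval (Less (Cell x (Lit 0)) u) s'"
    then obtain k where k: "k \<le> N" "s' x 0 = int k" "I k s'" "\<forall>a. a \<notin> insert x (mods c) \<longrightarrow> s' a = s a"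
      by (auto simp: J_def)
    have un: "aval u s' = int N" by (rule u) (use k in blast)
    have "k = N" using b k un by simp
    thus "Q s'" using k by (intro final) auto
  qed (use B L in auto)
  thus ?thesis unfolding For_def
    by (intro wp_Seq wp_Assign) (use B in auto)
qed

text \<open>Iteration over the rows is unrolled in the program text, which is possible because
  \<open>m\<close> is a constant.\<close>

fun seqs :: "(nat \<Rightarrow> com) \<Rightarrow> nat \<Rightarrow> com" where
  "seqs c 0 = Skip"
| "seqs c (Suc k) = Seq (seqs c k) (c k)"

lemma mods_seqs: "mods (seqs c k) = (\<Union>j<k. mods (c j))"
  by (induction k) (auto simp: less_Suc_eq)

lemma wp_seqs:
  assumes init: "I 0 s"
    and step: "\<And>j s'. j < k \<Longrightarrow> I j s' \<Longrightarrow> (\<And>a. a \<notin> mods (seqs c k) \<Longrightarrow> s' a = s a) \<Longrightarrow> wp L B (c j) s' (I (Suc j))"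
  shows "wp L B (seqs c k) s (I k)"
  using step
proof (induction k)
  case 0
  show ?case using init by (simp add: wp_Skip)
next
  case (Suc k)
  have "wp L B (seqs c k) s (I k)"
    by (rule Suc.IH, rule Suc.prems) (auto simp: mods_seqs)
  thus ?case unfolding seqs.simps
    by (rule wp_Seq[OF wp_conseq]) (rule Suc.prems, auto simp: mods_seqs)
qed

section \<open>Scalar products and determinants as single expressions\<close>

fun sumE :: "aexp list \<Rightarrow> aexp" where
  "sumE [] = Lit 0"
| "sumE (e # es) = Plus e (sumE es)"

fun prodE :: "aexp list \<Rightarrow> aexp" where
  "prodE [] = Lit 1"
| "prodE (e # es) = Times e (prodE es)"

lemma aval_sumE: "aval (sumE es) s = (\<Sum>e\<leftarrow>es. aval e s)"
  by (induction es) auto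

lemma aval_prodE: "aval (prodE es) s = (\<Prod>e\<leftarrow>es. aval e s)"
  by (induction es) auto

definition dotE :: "nat \<Rightarrow> (nat \<Rightarrow> aexp) \<Rightarrow> (nat \<Rightarrow> aexp) \<Rightarrow> aexp" where
  "dotE m e f = sumE (map (\<lambda>j. Times (e j) (f j)) [0..<m])"

lemma aval_dotE: "aval (dotE m e f) s = (\<Sum>j<m. aval (e j) s * aval (f j) s)"
  unfolding dotE_def aval_sumE map_map comp_def
  by (subst interv_sum_list_conv_sum_set_nat) (simp add: lessThan_atLeast0)

text \<open>Any enumeration will do: a program only has to exist for each \<open>m\<close>, so its
  text may be fixed by choice.\<close>

definition perm_list :: "nat \<Rightarrow> (nat \<Rightarrow> nat) list" where
  "perm_list m = (SOME ps. distinct ps \<and> set ps = {p. p permutes {0..<m}})"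

lemma perm_list: "distinct (perm_list m)" "set (perm_list m) = {p. p permutes {0..<m}}"
proof -
  have "\<exists>ps. distinct ps \<and> set ps = {p. p permutes {0..<m}}"
    using finite_distinct_list[OF finite_permutations[of "{0..<m}"]] by auto
  from someI_ex[OF this] show "distinct (perm_list m)" "set (perm_list m) = {p. p permutes {0..<m}}"
    unfolding perm_list_def by auto
qed

text \<open>Leibniz formula, which avoids the divisions and pivot searches of elimination.\<close>

definition detE :: "nat \<Rightarrow> (nat \<Rightarrow> nat \<Rightarrow> aexp) \<Rightarrow> aexp" where
  "detE m e = sumE (map (\<lambda>p. Times (Lit (signof p)) (prodE (map (\<lambda>i. e i (p i)) [0..<m]))) (perm_list m))"

lemma aval_detE: "aval (detE m e) s = det (mat m m (\<lambda>(i, j). aval (e i j) s))"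
proof -
  have "aval (detE m e) s = (\<Sum>p | p permutes {0..<m}. signof p * (\<Prod>i = 0..<m. aval (e i (p i)) s))"
    unfolding detE_def aval_sumE map_map comp_def perm_list(2)[symmetric]
    by (simp add: sum_list_distinct_conv_sum_set[OF perm_list(1)] aval_prodE comp_def
        prod.distinct_set_conv_list[symmetric] flip: atLeast_upt)
  also have "\<dots> = det (mat m m (\<lambda>(i, j). aval (e i j) s))"
    by (subst det_def'[where n = m]) (auto intro!: sum.cong prod.cong simp: permutes_in_image[of _ "{0..<m}", simplified])
  finally show ?thesis .
qed

section \<open>The program\<close>

abbreviation nE :: aexp where "nE \<equiv> Cell 0 (Lit 1)"
abbreviation ctr :: "nat \<Rightarrow> aexp" where "ctr x \<equiv> Cell x (Lit 0)"

text \<open>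
  Arrays of the program: 2 holds the common denominator \<open>D\<close> and 3 the scaled input; 4, 5 and 8 are loop
  counters; 6, 7 and \<open>colA j\<close> hold the first-stage costs, the nominal costs and row \<open>j\<close> of the matrix, padded with the
  \<open>m\<close> unit columns; \<open>selA k\<close> is the \<open>k\<close>-th enumeration counter.  For the current candidate \<open>f\<close>,
  9 is \<open>cd f\<close>, 10 is \<open>nm f\<close>, 11 is \<open>den f\<close>, 12 accumulates \<open>val f\<close>, 13 is positive as long as no constraint
  is violated, 14 is \<open>lhs f i\<close> and 15 is the first-stage solution.  The fraction 16/17 is the best value so
  far; it starts as 1/0, and the best solution is kept in the output array.
\<close>

definition countE :: "nat \<Rightarrow> aexp" where
  "countE m = Plus (Times (Lit (int m + 2)) nE) (Lit (int m))"

text \<open>The input array starts with its length, \<open>n\<close> and \<open>m\<close>, so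
  fraction \<open>k\<close> occupies cells \<open>2 * k + 3\<close> and \<open>2 * k + 4\<close>.
  Without division, each numerator is multiplied by all the other denominators in a double
  loop.\<close>

definition scale_prog :: "nat \<Rightarrow> com" where
  "scale_prog m =
    Seq (Assign 2 (Lit 0) (Lit 1))
   (Seq (For 4 (countE m) (Assign 2 (Lit 0) (Times (ctr 2) (Cell 0 (Plus (Times (Lit 2) (ctr 4)) (Lit 4))))))
   (For 4 (countE m)
     (Seq (Assign 3 (ctr 4) (Cell 0 (Plus (Times (Lit 2) (ctr 4)) (Lit 3))))
     (For 5 (countE m)
       (Cond (Conj (Neg (Less (ctr 4) (ctr 5))) (Neg (Less (ctr 5) (ctr 4)))) Skip
         (Assign 3 (ctr 4) (Times (Cell 3 (ctr 4)) (Cell 0 (Plus (Times (Lit 2) (ctr 5)) (Lit 4))))))))))"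

lemma int_less_power2: "k \<le> L \<Longrightarrow> L \<le> B \<Longrightarrow> int k < 2 ^ B"
proof -
  assume "k \<le> L" "L \<le> B"
  hence "k < 2 ^ B" using less_exp[of B] by linarith
  thus ?thesis by (metis of_nat_less_iff of_nat_numeral of_nat_power)
qed

text \<open>Bounding \<open>prod q S\<close> for every subset \<open>S\<close> covers all
  intermediate products; together with the numerator this gives at most
  \<open>2 ^ (2 * L)\<close>.\<close>

lemma wp_scale:
  fixes p q :: "nat \<Rightarrow> int"
  assumes B: "2 * L < B" and M: "M = (m + 2) * n + m" "M \<le> L"
    and n: "s 0 1 = int n"
    and pq: "\<And>k. k < M \<Longrightarrow> s 0 (2 * int k + 3) = p k" "\<And>k. k < M \<Longrightarrow> s 0 (2 * int k + 4) = q k"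
    and p: "\<And>k. k < M \<Longrightarrow> \<bar>p k\<bar> \<le> 2 ^ L" and q: "\<And>S. S \<subseteq> {..<M} \<Longrightarrow> \<bar>prod q S\<bar> \<le> 2 ^ L"
  shows "wp L B (scale_prog m) s (\<lambda>s'. s' 2 0 = prod q {..<M} \<and>
    (\<forall>k<M. s' 3 (int k) = p k * prod q ({..<M} - {k})))"
proof -
  have B0: "0 < B" using B by simp
  have MB: "int M < 2 ^ B" using int_less_power2[of M L B] M B by simp
  have LB: "(2::int) ^ L < 2 ^ B" using B by (intro power_strict_increasing) auto
  have cnt: "aval (countE m) s' = int M" if "s' 0 = s 0" for s'
    using that n M by (simp add: countE_def algebra_simps)
  have bound: "\<bar>p k * prod q S\<bar> < 2 ^ B" if "k < M" "S \<subseteq> {..<M}" for k S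
  proof -
    have "\<bar>p k * prod q S\<bar> \<le> 2 ^ L * 2 ^ L"
      unfolding abs_mult using p q that by (intro mult_mono) auto
    also have "\<dots> = 2 ^ (2 * L)" by (simp add: power_add mult_2)
    also have "\<dots> < 2 ^ B" using B by (intro power_strict_increasing) auto
    finally show ?thesis .
  qed
  let ?F = "\<lambda>k. p k * prod q ({..<M} - {k})"
  show ?thesis unfolding scale_prog_def
  proof (rule wp_Seq, rule wp_Assign[OF B0], simp add: one_less_power B0, simp, rule wp_Seq,
      rule wp_For[where I = "\<lambda>k s'. s' 2 0 = prod q {..<k}" and N = M], goal_cases)
    case (5 s')
    thus ?case using cnt by simp
  next
    case (8 k s')
    hence s: "s' 0 (2 * int k + 4) = q k" using pq by simp
    have "prod q {..<Suc k} = prod q {..<k} * q k" by simp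
    moreover have "\<bar>prod q {..<Suc k}\<bar> < 2 ^ B" by (rule le_less_trans[OF q LB]) (use 8(1) in auto)
    ultimately show ?case using 8 s by (intro wp_Assign[OF B0]) auto
  next
    case (9 s1)
    hence s1: "s1 0 = s 0" "s1 2 0 = prod q {..<M}" by auto
    show ?case
    proof (rule wp_For[where I = "\<lambda>k s'. \<forall>k'<k. s' 3 (int k') = ?F k'" and N = M], goal_cases)
      case (5 s')
      thus ?case using cnt s1 by (simp add: mods_For)
    next
      case (8 k s')
      hence s': "s' 0 = s 0" "s' 2 = s1 2" using s1 by (auto simp: mods_For)
      show ?case
      proof (rule wp_Seq, rule wp_Assign[OF B0], goal_cases)
        case 1
        show ?case using 8 s' pq bound[of k "{}"] by simp
      next
        case 2
        show ?case
        proof (rule wp_For[where I = "\<lambda>l s'. s' 3 (int k) = p k * prod q ({..<l} - {k}) \<and> (\<forall>k'<k. s' 3 (int k') = ?F k')"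
              and N = M], goal_cases)
          case (5 s'')
          thus ?case using cnt s' by simp
        next
          case (7)
          show ?case using 8 s' pq by auto
        next
          case c8: (8 l s'')
          hence s'': "s'' 0 = s 0" "s'' 4 0 = int k" "s'' 5 0 = int l" using s' 8 by auto
          show ?case
          proof (rule wp_Cond[OF B0], goal_cases)
            case 1
            hence "l = k" using s'' by simp
            hence "{..<Suc l} - {k} = {..<l} - {k}" by auto
            thus ?case using c8 by (intro wp_Skip) simp
          next
            case 2
            hence "l \<noteq> k" using s'' by auto
            hence "{..<Suc l} - {k} = insert l ({..<l} - {k})" by auto
            hence e: "prod q ({..<Suc l} - {k}) = prod q ({..<l} - {k}) * q l" by simp
            have "\<bar>p k * prod q ({..<Suc l} - {k})\<bar> < 2 ^ B"
              by (rule bound) (use c8 8 in auto)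
            thus ?case unfolding e using c8 s'' pq(2)[of l] by (intro wp_Assign[OF B0]) (auto simp: mult.assoc)
          qed
        next
          case (9 s'')
          thus ?case by (auto simp: less_Suc_eq)
        qed (use M MB B0 in auto)
      qed
    next
      case (9 s')
      thus ?case using s1 by (simp add: mods_For)
    qed (use M MB B0 in \<open>auto simp: mods_For\<close>)
  qed (use M MB B0 in auto)
qed

text \<open>Even and odd numbers from 20 on keep the two families apart from each other and from the
  fixed arrays.\<close>

abbreviation colA :: "nat \<Rightarrow> nat" where "colA j \<equiv> 2 * j + 20"
abbreviation selA :: "nat \<Rightarrow> nat" where "selA k \<equiv> 2 * k + 21"

definition colsE :: "nat \<Rightarrow> aexp" where
  "colsE m = Plus nE (Lit (int m))"

definition table_prog :: "nat \<Rightarrow> com" where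
  "table_prog m =
    Seq (For 4 nE
     (Seq (Assign 6 (ctr 4) (Cell 3 (ctr 4)))
     (Seq (Assign 7 (ctr 4) (Cell 3 (Plus nE (ctr 4))))
     (seqs (\<lambda>j. Assign (colA j) (ctr 4) (Cell 3 (Plus (Times nE (Lit (int j + 2))) (ctr 4)))) m))))
    (seqs (\<lambda>j. Assign (colA j) (Plus nE (Lit (int j))) (ctr 2)) m)"

lemma mods_table: "mods (table_prog m) = {4, 6, 7} \<union> colA ` {..<m}"
  by (auto simp: table_prog_def mods_For mods_seqs)

lemma wp_table:
  assumes B: "0 < B" "n \<le> L" "int n < 2 ^ B" and n: "s 0 1 = int n"
    and z: "s 6 = (\<lambda>_. 0)" "s 7 = (\<lambda>_. 0)" "\<And>j. j < m \<Longrightarrow> s (colA j) = (\<lambda>_. 0)"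
  shows "wp L B (table_prog m) s (\<lambda>s'.
    (\<forall>i<n + m. s' 6 (int i) = (if i < n then s 3 (int i) else 0)) \<and>
    (\<forall>i<n + m. s' 7 (int i) = (if i < n then s 3 (int (n + i)) else 0)) \<and>
    (\<forall>j<m. \<forall>i<n + m. s' (colA j) (int i) = (if i < n then s 3 (int (n * (j + 2) + i)) else if i = n + j then s 2 0 else 0)))"
  (is "wp L B _ s ?Q")
proof (rule wp_bounded)
  assume bs: "bounded_cells B s"
  hence bd: "\<bar>s a i\<bar> < 2 ^ B" for a i by (simp add: bounded_cells_def)
  \<comment> \<open>The statement covers all \<open>i\<close>, not only \<open>i < k\<close>: cells
    not yet reached are still zero, and these zeros become the padding.\<close>
  define I where "I = (\<lambda>k s'. (\<forall>i. s' 6 (int i) = (if i < k then s 3 (int i) else 0)) \<and>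
    (\<forall>i. s' 7 (int i) = (if i < k then s 3 (int (n + i)) else 0)) \<and>
    (\<forall>j<m. \<forall>i. s' (colA j) (int i) = (if i < k then s 3 (int (n * (j + 2) + i)) else 0)))"
  show ?thesis unfolding table_prog_def
  proof (rule wp_Seq, rule wp_For[where I = I and N = n], goal_cases)
    case (4)
    show ?case by (auto simp: mods_seqs)
  next
    case (5 s')
    thus ?case using n by (simp add: mods_seqs)
  next
    case (6 k s' y)
    thus ?case by (simp add: I_def)
  next
    case 7
    show ?case using z by (simp add: I_def)
  next
    case (8 k s')
    have fr: "s' 0 = s 0" "s' 3 = s 3" using 8(4) by (auto simp: mods_seqs)
    let ?s1 = "s'(6 := (s' 6)(int k := s 3 (int k)))"
    let ?s2 = "?s1(7 := (s' 7)(int k := s 3 (int (n + k))))"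
    have "wp L B (seqs (\<lambda>j. Assign (colA j) (ctr 4) (Cell 3 (Plus (Times nE (Lit (int j + 2))) (ctr 4)))) m) ?s2
      (\<lambda>s''. s'' 6 = ?s2 6 \<and> s'' 7 = ?s2 7 \<and> (\<forall>j<m. s'' (colA j) =
        (if j < m then (s' (colA j))(int k := s 3 (int (n * (j + 2) + k))) else s' (colA j))))"
    proof (rule wp_seqs[where I = "\<lambda>j0 s''. s'' 6 = ?s2 6 \<and> s'' 7 = ?s2 7 \<and> (\<forall>j<m. s'' (colA j) =
        (if j < j0 then (s' (colA j))(int k := s 3 (int (n * (j + 2) + k))) else s' (colA j)))"], goal_cases)
      case (2 j s'')
      have f: "s'' 0 = s 0" "s'' 3 = s 3" "s'' 4 0 = int k" using 2(3) fr 8(3) by (auto simp: mods_seqs)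
      have "int n * (2 + int j) + int k = int (n * (j + 2) + k)" by (simp add: algebra_simps)
      thus ?case using 2 f n bd by (intro wp_Assign[OF B(1)]) (auto simp: less_Suc_eq algebra_simps)
    qed auto
    hence "wp L B (seqs (\<lambda>j. Assign (colA j) (ctr 4) (Cell 3 (Plus (Times nE (Lit (int j + 2))) (ctr 4)))) m) ?s2 (I (Suc k))"
      by (rule wp_conseq) (use 8(2) in \<open>auto simp: I_def\<close>)
    thus ?case
      using fr n 8(3) bd by (intro wp_Seq wp_Assign[OF B(1)]) (auto simp: algebra_simps)
  next
    case (9 s1)
    have fr: "s1 0 = s 0" "s1 2 = s 2" "s1 3 = s 3" using 9(2) by (auto simp: mods_seqs)
    show ?case
    proof (rule wp_conseq[OF wp_seqs[where I = "\<lambda>j0 s'. s' 6 = s1 6 \<and> s' 7 = s1 7 \<and> (\<forall>j<m. s' (colA j) =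
        (if j < j0 then (s1 (colA j))(int (n + j) := s 2 0) else s1 (colA j)))"]], goal_cases)
      case (2 j s')
      have f: "s' 0 = s 0" "s' 2 = s 2" using 2(3) fr by (auto simp: mods_seqs)
      show ?case using 2 f n bd by (intro wp_Assign[OF B(1)]) (auto simp: less_Suc_eq)
    next
      case (3 s')
      thus ?case using 9(1) by (auto simp: I_def)
    qed auto
  qed (use B in auto)
qed

definition eval_prog :: "nat \<Rightarrow> com" where
  "eval_prog m =
    Seq (Assign 9 (Lit 0) (detE m (\<lambda>k j. Cell (colA j) (ctr (selA k)))))
   (Seq (seqs (\<lambda>j0. Assign 10 (Lit (int j0)) (Times (ctr 9)
      (detE m (\<lambda>k j. if j = j0 then Times (ctr 2) (ctr (selA (m + k))) else Cell (colA j) (ctr (selA k)))))) m)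
   (Seq (Assign 11 (Lit 0) (Times (ctr 9) (ctr 9)))
   (Seq (Assign 12 (Lit 0) (dotE m (\<lambda>j. Cell 3 (Plus (Times (Lit (int m + 2)) nE) (Lit (int j)))) (\<lambda>j. Cell 10 (Lit (int j)))))
   (Seq (Assign 13 (Lit 0) (Lit 1))
   (For 8 (colsE m)
     (Seq (Assign 14 (Lit 0) (dotE m (\<lambda>j. Cell (colA j) (ctr 8)) (\<lambda>j. Cell 10 (Lit (int j)))))
     (Seq (Cond (Less (ctr 14) (Lit 0)) (Assign 13 (Lit 0) (Lit 0)) Skip)
     (Cond (Conj (Neg (Less (ctr 14) (Times (ctr 2) (ctr 11)))) (Less (Cell 7 (ctr 8)) (Cell 6 (ctr 8))))
       (Seq (Assign 15 (ctr 8) (Lit 0)) (Assign 12 (Lit 0) (Plus (ctr 12) (Times (Cell 7 (ctr 8)) (ctr 11)))))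
       (Seq (Assign 15 (ctr 8) (Lit 1)) (Assign 12 (Lit 0) (Plus (ctr 12) (Times (Cell 6 (ctr 8)) (ctr 11)))))))))))))"

text \<open>Fractions are compared by cross multiplication, where the initial 1/0 acts as infinity.
  The offset 3 skips the output length and the two cells of the optimal value.\<close>

definition keep_prog :: com where
  "keep_prog =
    Cond (Conj (Less (Lit 0) (ctr 13)) (Less (Times (ctr 12) (ctr 17)) (Times (ctr 16) (ctr 11))))
     (Seq (Assign 16 (Lit 0) (ctr 12))
     (Seq (Assign 17 (Lit 0) (ctr 11))
     (For 8 nE (Assign 1 (Plus (ctr 8) (Lit 3)) (Cell 15 (ctr 8))))))
     Skip"

fun search_prog :: "nat \<Rightarrow> nat \<Rightarrow> com" where
  "search_prog m 0 = Seq (eval_prog m) keep_prog"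
| "search_prog m (Suc k) = For (selA k) (if k < m then colsE m else Lit 2) (search_prog m k)"

lemma mods_eval: "mods (eval_prog m) = {8, 9, 11, 12, 13, 14, 15} \<union> (if m = 0 then {} else {10})"
  by (auto simp: eval_prog_def mods_For mods_seqs)

lemma mods_keep: "mods keep_prog = {1, 8, 16, 17}"
  by (auto simp: keep_prog_def mods_For)

lemma mods_search: "mods (search_prog m k) = mods (eval_prog m) \<union> mods keep_prog \<union> selA ` {..<k}"
  by (induction k) (auto simp: mods_For less_Suc_eq)

section \<open>Bit-length bounds and evaluation of candidates\<close>

lemma det_cong:
  assumes "\<And>k j. k < m \<Longrightarrow> j < m \<Longrightarrow> F k j = G k j"
  shows "det (mat m m (\<lambda>(k, j). F k j)) = det (mat m m (\<lambda>(k, j). G k j))"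
  by (rule arg_cong[of _ _ det]) (use assms in \<open>auto intro!: eq_matI\<close>)

lemma det_bound:
  fixes F :: "nat \<Rightarrow> nat \<Rightarrow> int"
  assumes "\<And>k j. k < m \<Longrightarrow> j < m \<Longrightarrow> \<bar>F k j\<bar> \<le> X"
  shows "\<bar>det (mat m m (\<lambda>(k, j). F k j))\<bar> \<le> fact m * X ^ m"
proof -
  let ?P = "{p. p permutes {0..<m}}"
  have "\<bar>det (mat m m (\<lambda>(k, j). F k j))\<bar> \<le> (\<Sum>p\<in>?P. \<bar>signof p * (\<Prod>k = 0..<m. mat m m (\<lambda>(k, j). F k j) $$ (k, p k))\<bar>)"
    by (subst det_def'[where n = m]) (auto intro: sum_abs)
  also have "\<dots> \<le> (\<Sum>p\<in>?P. X ^ m)"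
  proof (rule sum_mono)
    fix p assume p: "p \<in> ?P"
    have "\<bar>signof p * (\<Prod>k = 0..<m. mat m m (\<lambda>(k, j). F k j) $$ (k, p k))\<bar> =
        (\<Prod>k = 0..<m. \<bar>mat m m (\<lambda>(k, j). F k j) $$ (k, p k)\<bar>)"
      by (simp add: abs_mult sign_def abs_prod)
    also have "\<dots> \<le> (\<Prod>k = 0..<m. X)"
      by (rule prod_mono) (use p assms in \<open>auto simp: permutes_in_image[of _ "{0..<m}", simplified]\<close>)
    finally show "\<bar>signof p * (\<Prod>k = 0..<m. mat m m (\<lambda>(k, j). F k j) $$ (k, p k))\<bar> \<le> X ^ m" by simp
  qed
  also have "\<dots> = fact m * X ^ m" using card_permutations[of "{0..<m}" m] by simp
  finally show ?thesis .
qed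

lemma dot_bound:
  fixes u v :: "nat \<Rightarrow> int"
  assumes "\<And>j. j < m \<Longrightarrow> \<bar>u j\<bar> \<le> X" "\<And>j. j < m \<Longrightarrow> \<bar>v j\<bar> \<le> Y" "0 \<le> X"
  shows "\<bar>dot m u v\<bar> \<le> int m * (X * Y)"
proof -
  have "\<bar>dot m u v\<bar> \<le> (\<Sum>j<m. \<bar>u j * v j\<bar>)" unfolding dot_def by (rule sum_abs)
  also have "\<dots> \<le> (\<Sum>j<m. X * Y)"
    unfolding abs_mult by (intro sum_mono mult_mono) (use assms in auto)
  finally show ?thesis by simp
qed

text \<open>\<open>X\<close> bounds the scaled data and \<open>Y\<close> the determinants. The
  factor in \<open>Z\<close> counts summands of a value \<open>val f\<close>, each at most
  \<open>X * Y\<^sup>2\<close>: \<open>m\<close> from the scalar product with \<open>b\<close>,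
  \<open>n + m\<close> from the costs, and one spare.\<close>

locale machine_data = scaled_data +
  fixes L B :: nat and X Y :: int
  defines "Y \<equiv> fact m * X ^ m"
  assumes X: "D \<le> X"
      "\<And>i j. i < n + m \<Longrightarrow> j < m \<Longrightarrow> \<bar>a i j\<bar> \<le> X" "\<And>i. i < n + m \<Longrightarrow> \<bar>c i\<bar> \<le> X"
      "\<And>i. i < n + m \<Longrightarrow> \<bar>l i\<bar> \<le> X" "\<And>j. j < m \<Longrightarrow> \<bar>b j\<bar> \<le> X"
    and Z: "(int (n + m) + int m + 1) * (X * Y\<^sup>2) < 2 ^ B"
    and L: "n + m + 2 \<le> L" "L \<le> B"
begin

definition stored :: "store \<Rightarrow> bool" where
  "stored s \<longleftrightarrow> s 0 1 = int n \<and> s 2 0 = D \<and>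
    (\<forall>i<n + m. s 6 (int i) = c i \<and> s 7 (int i) = l i) \<and>
    (\<forall>j<m. \<forall>i<n + m. s (colA j) (int i) = a i j) \<and>
    (\<forall>j<m. s 3 ((int m + 2) * int n + int j) = b j)"

lemma stored_cong:
  assumes "stored s" "s' 0 = s 0" "s' 2 = s 2" "s' 3 = s 3" "s' 6 = s 6" "s' 7 = s 7"
    "\<And>j. j < m \<Longrightarrow> s' (colA j) = s (colA j)"
  shows "stored s'"
  using assms unfolding stored_def by simp

lemma X1: "1 \<le> X" using X(1) D_pos by linarith
lemma Y1: "1 \<le> Y" unfolding Y_def
  using mult_mono[of 1 "fact m :: int" 1 "X ^ m"] X1 by (simp add: one_le_power)
lemma B0: "0 < B" using L by simp

lemma XY1: "1 \<le> X * Y\<^sup>2"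
  using mult_mono[of 1 X 1 "Y\<^sup>2"] X1 Y1 by (simp add: one_le_power)

lemma XYB: "k \<le> n + m \<Longrightarrow> z \<le> (int k + int m + 1) * (X * Y\<^sup>2) \<Longrightarrow> z < 2 ^ B"
proof -
  assume "k \<le> n + m" "z \<le> (int k + int m + 1) * (X * Y\<^sup>2)"
  moreover have "(int k + int m + 1) * (X * Y\<^sup>2) \<le> (int (n + m) + int m + 1) * (X * Y\<^sup>2)"
    using XY1 \<open>k \<le> n + m\<close> by (intro mult_right_mono) auto
  ultimately show ?thesis using Z by linarith
qed

lemma bound_one: "z \<le> X * Y\<^sup>2 \<Longrightarrow> z < 2 ^ B"
  by (rule XYB[of 0]) (use XY1 mult_right_mono[of 1 "int m + 1" "X * Y\<^sup>2"] in auto)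

definition valid :: "(nat \<Rightarrow> nat) \<Rightarrow> bool" where
  "valid f \<longleftrightarrow> (\<forall>k<m + m. f k < choices k)"

lemma valid_less:
  assumes "valid f" "k < m" shows "f k < n + m" "f (m + k) < 2"
  using assms(1)[unfolded valid_def, rule_format, of k] assms(1)[unfolded valid_def, rule_format, of "m + k"] assms(2)
  by (auto simp: choices_def)

lemma cd_bound: "valid f \<Longrightarrow> \<bar>cd f\<bar> \<le> Y"
  unfolding cd_def Y_def by (rule det_bound) (auto intro: X valid_less)

lemma cnum_bound:
  assumes f: "valid f" shows "\<bar>cnum f j\<bar> \<le> Y"
  unfolding cnum_def Y_def
proof (rule det_bound)
  fix k j' assume k: "k < m" "j' < m"
  have "D * int (f (m + k)) \<le> D * 1"
    using valid_less(2)[OF f k(1)] D_pos by (intro mult_left_mono) auto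
  hence "D * int (f (m + k)) \<le> X" using X(1) by linarith
  thus "\<bar>if j' = j then D * int (f (m + k)) else a (f k) j'\<bar> \<le> X"
    using X(1,2) D_pos k valid_less(1)[OF f] by (auto simp: abs_mult)
qed

lemma nm_bound: "valid f \<Longrightarrow> \<bar>nm f j\<bar> \<le> Y\<^sup>2"
  unfolding nm_def abs_mult power2_eq_square
  using cd_bound cnum_bound Y1 by (intro mult_mono) auto

lemma den_bound: "valid f \<Longrightarrow> \<bar>den f\<bar> \<le> Y\<^sup>2"
  unfolding den_def abs_mult power2_eq_square
  using cd_bound Y1 by (intro mult_mono) auto

lemma den_nonneg: "0 \<le> den f" by (simp add: den_def)

lemma Y2_le: "Y\<^sup>2 \<le> X * Y\<^sup>2"
  using mult_right_mono[of 1 X "Y\<^sup>2"] X1 by simp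

lemma Y_le: "Y \<le> Y\<^sup>2"
  using mult_left_mono[of 1 Y Y] Y1 by (simp add: power2_eq_square)

lemma lhs_bound:
  assumes "valid f" "i < n + m" shows "\<bar>lhs f i\<bar> < 2 ^ B"
proof (rule XYB[of 0])
  have "\<bar>lhs f i\<bar> \<le> int m * (X * Y\<^sup>2)"
    unfolding lhs_def by (rule dot_bound) (use assms X nm_bound X1 in auto)
  thus "\<bar>lhs f i\<bar> \<le> (int 0 + int m + 1) * (X * Y\<^sup>2)" using XY1 by (simp add: algebra_simps)
qed simp

lemma pval_bound:
  assumes "valid f" "k \<le> n + m" shows "\<bar>pval f k\<bar> < 2 ^ B"
proof (rule XYB[OF assms(2)])
  have "\<bar>dot m b (nm f)\<bar> \<le> int m * (X * Y\<^sup>2)"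
    by (rule dot_bound) (use assms X nm_bound X1 in auto)
  moreover have "\<bar>\<Sum>i<k. (if buy f i then c i else l i) * den f\<bar> \<le> (\<Sum>i<k. X * Y\<^sup>2)"
    by (rule order_trans[OF sum_abs], rule sum_mono, unfold abs_mult, rule mult_mono)
       (use assms X den_bound X1 in auto)
  ultimately have "\<bar>pval f k\<bar> \<le> int m * (X * Y\<^sup>2) + int k * (X * Y\<^sup>2)"
    unfolding pval_def by simp
  thus "\<bar>pval f k\<bar> \<le> (int k + int m + 1) * (X * Y\<^sup>2)" using XY1 by (simp add: algebra_simps)
qed

lemma wp_eval:
  assumes st: "stored s" and f: "valid f" and sel: "\<And>k. k < m + m \<Longrightarrow> s (selA k) 0 = int (f k)"
  shows "wp L B (eval_prog m) s (\<lambda>s'. s' 11 0 = den f \<and> s' 12 0 = val f \<and>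
    (0 < s' 13 0 \<longleftrightarrow> (\<forall>i<n + m. lhs f i \<ge> 0)) \<and> (\<forall>i<n + m. s' 15 (int i) = of_bool (buy f i)))"
proof -
  have a: "s (colA j) (int (f k)) = a (f k) j" if "k < m" "j < m" for k j
    using st valid_less(1)[OF f] that by (simp add: stored_def)
  have cdv: "det (mat m m (\<lambda>(k, j). s (colA j) (s (selA k) 0))) = cd f"
    unfolding cd_def by (rule det_cong) (use a sel in auto)
  let ?s1 = "s(9 := (s 9)(0 := cd f))"
  \<comment> \<open>Stated for every store differing from \<open>?s1\<close> only in array 10, so
    that it applies at each stage of the unrolled assignments to that array.\<close>
  have nmE: "aval (Times (ctr 9) (detE m (\<lambda>k j. if j = j0 then Times (ctr 2) (ctr (selA (m + k)))
      else Cell (colA j) (ctr (selA k))))) s' = nm f j0"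
    if s': "\<And>a. a \<noteq> 10 \<Longrightarrow> s' a = ?s1 a" for s' j0
  proof -
    have e: "s' 9 0 = cd f" "s' 2 0 = D" "\<And>j. s' (colA j) = s (colA j)" "\<And>k. s' (selA (m + k)) = s (selA (m + k))"
        "\<And>j. s' (selA j) = s (selA j)"
      using s' st by (auto simp: stored_def)
    have "det (mat m m (\<lambda>(k, j). aval (if j = j0 then Times (ctr 2) (ctr (selA (m + k)))
      else Cell (colA j) (ctr (selA k))) s')) = cnum f j0"
      unfolding cnum_def by (rule det_cong) (use a sel[of "m + _"] sel e in auto)
    thus ?thesis unfolding nm_def by (simp add: aval_detE e)
  qed
  have nmB: "\<bar>nm f j\<bar> < 2 ^ B" for j using nm_bound[OF f, of j] Y2_le by (intro bound_one) linarith
  show ?thesis unfolding eval_prog_def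
  proof (rule wp_Seq, rule wp_Assign[OF B0], goal_cases)
    case 1
    have "\<bar>cd f\<bar> < 2 ^ B" using cd_bound[OF f] Y2_le Y_le by (intro bound_one) linarith
    thus ?case by (simp add: aval_detE cdv)
  next
    case 2
    have s1: "s(9 := (s 9)(aval (Lit 0) s := aval (detE m (\<lambda>k j. Cell (colA j) (ctr (selA k)))) s)) = ?s1"
      by (simp add: aval_detE cdv)
    show ?case unfolding s1
    proof (rule wp_Seq, rule wp_conseq[OF wp_seqs[where I = "\<lambda>j0 s'. \<forall>j<j0. s' 10 (int j) = nm f j"]], goal_cases)
      case 1
      show ?case by simp
    next
      case (2 j s')
      have "\<And>a. a \<noteq> 10 \<Longrightarrow> s' a = ?s1 a" using 2(3) by (auto simp: mods_seqs)
      from nmE[OF this, of j] show ?case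
        using nmB[of j] 2(2) by (intro wp_Assign[OF B0]) (auto simp: less_Suc_eq simp del: aval.simps(5))
    next
      case (3 s2)
      have s2: "\<And>a. a \<noteq> 10 \<Longrightarrow> s2 a = ?s1 a" "\<And>j. j < m \<Longrightarrow> s2 10 (int j) = nm f j"
        using 3 by (auto simp: mods_seqs)
      have t0: "s2 0 1 = int n" "s2 9 0 = cd f" using s2(1) st by (auto simp: stored_def)
      let ?s3 = "s2(11 := (s2 11)(0 := den f))"
      let ?s4 = "?s3(12 := (s2 12)(0 := pval f 0))"
      let ?s5 = "?s4(13 := (s2 13)(0 := 1))"
      have v: "aval (dotE m (\<lambda>j. Cell 3 (Plus (Times (Lit (int m + 2)) nE) (Lit (int j)))) (\<lambda>j. Cell 10 (Lit (int j)))) ?s3 = pval f 0"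
        unfolding aval_dotE pval_def dot_def using s2 st by (auto intro!: sum.cong simp: stored_def)
      have denB: "\<bar>den f\<bar> < 2 ^ B" using den_bound[OF f] Y2_le by (intro bound_one) linarith
      have "wp L B (For 8 (colsE m)
     (Seq (Assign 14 (Lit 0) (dotE m (\<lambda>j. Cell (colA j) (ctr 8)) (\<lambda>j. Cell 10 (Lit (int j)))))
     (Seq (Cond (Less (ctr 14) (Lit 0)) (Assign 13 (Lit 0) (Lit 0)) Skip)
     (Cond (Conj (Neg (Less (ctr 14) (Times (ctr 2) (ctr 11)))) (Less (Cell 7 (ctr 8)) (Cell 6 (ctr 8))))
       (Seq (Assign 15 (ctr 8) (Lit 0)) (Assign 12 (Lit 0) (Plus (ctr 12) (Times (Cell 7 (ctr 8)) (ctr 11)))))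
       (Seq (Assign 15 (ctr 8) (Lit 1)) (Assign 12 (Lit 0) (Plus (ctr 12) (Times (Cell 6 (ctr 8)) (ctr 11)))))))))
       ?s5 (\<lambda>s'. s' 11 0 = den f \<and> s' 12 0 = val f \<and>
    (0 < s' 13 0 \<longleftrightarrow> (\<forall>i<n + m. lhs f i \<ge> 0)) \<and> (\<forall>i<n + m. s' 15 (int i) = of_bool (buy f i)))"
        (is "wp L B (For 8 _ ?body) _ ?Q")
      proof (rule wp_For[where N = "n + m" and I = "\<lambda>i s'. s' 12 0 = pval f i \<and>
          (0 < s' 13 0 \<longleftrightarrow> (\<forall>i'<i. lhs f i' \<ge> 0)) \<and> (\<forall>i'<i. s' 15 (int i') = of_bool (buy f i'))"], goal_cases)
        case 3
        show ?case using int_less_power2[of "n + m" L B] L by simp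
      next
        case (5 s')
        have "s' 0 = s2 0" using 5[of 0] by simp
        thus ?case using t0 by (simp add: colsE_def)
      next
        case (8 i s')
        have e: "s' 2 0 = D" "s' 7 (int i) = l i" "s' 6 (int i) = c i" "s' 11 0 = den f"
          "\<And>j. j < m \<Longrightarrow> s' (colA j) (int i) = a i j" "\<And>j. j < m \<Longrightarrow> s' 10 (int j) = nm f j"
          using 8(1,4) s2 st by (auto simp: stored_def)
        have w: "aval (dotE m (\<lambda>j. Cell (colA j) (ctr 8)) (\<lambda>j. Cell 10 (Lit (int j)))) s' = lhs f i"
          unfolding aval_dotE lhs_def dot_def using e 8(3) by (auto intro!: sum.cong)
        let ?t1 = "s'(14 := (s' 14)(0 := lhs f i))"
        have pS: "pval f (Suc i) = pval f i + (if buy f i then c i else l i) * den f"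
          by (simp add: pval_def)
        have pB: "\<bar>pval f (Suc i)\<bar> < 2 ^ B" by (rule pval_bound[OF f]) (use 8 in simp)
        have one: "(1::int) < 2 ^ B" using B0 by simp
        show ?case
        proof (rule wp_Seq, rule wp_Assign[OF B0], goal_cases)
          case 1
          show ?case unfolding w using lhs_bound[OF f 8(1)] .
        next
          case 2
          have t1: "s'(14 := (s' 14)(aval (Lit 0) s' := aval (dotE m (\<lambda>j. Cell (colA j) (ctr 8)) (\<lambda>j. Cell 10 (Lit (int j)))) s')) = ?t1"
            by (simp add: w)
          have ok: "wp L B (Cond (Less (ctr 14) (Lit 0)) (Assign 13 (Lit 0) (Lit 0)) Skip) ?t1
             (\<lambda>t. (0 < t 13 0 \<longleftrightarrow> (\<forall>i'<Suc i. lhs f i' \<ge> 0)) \<and> (\<forall>a. a \<noteq> 13 \<longrightarrow> t a = ?t1 a))"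
          proof (rule wp_Cond[OF B0], goal_cases)
            case 1
            thus ?case using 8(2) by (intro wp_Assign[OF B0]) (auto simp: less_Suc_eq)
          next
            case 2
            thus ?case using 8(2) by (intro wp_Skip) (auto simp: less_Suc_eq)
          qed
          show ?case unfolding t1
          proof (rule wp_Seq, rule wp_conseq[OF ok], goal_cases)
            case (1 t)
            have t: "\<And>a. a \<noteq> 13 \<Longrightarrow> t a = ?t1 a" and ok: "0 < t 13 0 \<longleftrightarrow> (\<forall>i'<Suc i. lhs f i' \<ge> 0)"
              using 1(3) by blast+
            have te: "t 2 0 = D" "t 7 (int i) = l i" "t 6 (int i) = c i" "t 11 0 = den f" "t 8 0 = int i" "t 14 0 = lhs f i"
              "t 12 0 = pval f i" "\<forall>i'<i. t 15 (int i') = of_bool (buy f i')"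
              using t e 8 by auto
            show ?case
            proof (rule wp_Cond[OF B0], goal_cases)
              case 1
              hence "\<not> buy f i" using te by (auto simp: buy_def)
              thus ?case using te pB ok unfolding pS
                by (intro wp_Seq wp_Assign[OF B0]) (auto simp: less_Suc_eq)
            next
              case 2
              hence "buy f i" using te by (auto simp: buy_def)
              thus ?case using te pB ok one unfolding pS
                by (intro wp_Seq wp_Assign[OF B0]) (auto simp: less_Suc_eq)
            qed
          qed
        qed
      next
        case (9 s')
        have "s' 11 = ?s5 11" using 9(2) by auto
        thus ?case using 9(1) by auto
      qed (use L B0 in auto)
      thus ?case using t0 v denB pval_bound[OF f, of 0] B0
        by (intro wp_Seq wp_Assign[OF B0]) (auto simp: den_def[symmetric])
    qed
  qed
qed

text \<open>\<open>S\<close> is the set of candidates seen so far. Validity of \<open>g\<close> is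
  recorded because the size bounds for \<open>val g\<close> and \<open>den g\<close>, required when
  the result is written, rest on it.\<close>

definition best :: "(nat \<Rightarrow> nat) set \<Rightarrow> store \<Rightarrow> bool" where
  "best S s \<longleftrightarrow> s 17 0 = 0 \<and> s 16 0 = 1 \<and> (\<forall>f\<in>S. \<not> feas f) \<or>
    (\<exists>g. valid g \<and> feas g \<and> s 17 0 = den g \<and> s 16 0 = val g \<and> (\<forall>i<n. s 1 (int i + 3) = of_bool (buy g i)) \<and>
      (\<forall>f\<in>S. feas f \<longrightarrow> val g * den f \<le> val f * den g))"

lemma best_cong: "best S s \<Longrightarrow> s' 1 = s 1 \<Longrightarrow> s' 16 = s 16 \<Longrightarrow> s' 17 = s 17 \<Longrightarrow> best S s'"
  by (simp add: best_def)

text \<open>Transitivity of \<open>x / u \<le> y / v \<le> z / w\<close>, cleared of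
  denominators.\<close>

lemma fraction_le_trans:
  fixes x y z u v w :: int
  assumes "x * v \<le> y * u" "y * w \<le> z * v" "0 < u" "0 < v" "0 < w"
  shows "x * w \<le> z * u"
proof -
  have "(x * w) * v = (x * v) * w" by simp
  also have "\<dots> \<le> (y * u) * w" using assms by (intro mult_right_mono) auto
  also have "\<dots> = (y * w) * u" by simp
  also have "\<dots> \<le> (z * v) * u" using assms by (intro mult_right_mono) auto
  also have "\<dots> = (z * u) * v" by simp
  finally show ?thesis using assms(4) by simp
qed

lemma wp_keep:
  assumes st: "s 0 1 = int n" and f: "valid f" and b: "best S s"
    and s: "s 11 0 = den f" "s 12 0 = val f" "0 < s 13 0 \<longleftrightarrow> (\<forall>i<n + m. lhs f i \<ge> 0)"
      "\<forall>i<n + m. s 15 (int i) = of_bool (buy f i)"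
  shows "wp L B keep_prog s (best (insert f S))"
proof (rule wp_bounded)
  assume bd: "bounded_cells B s"
  \<comment> \<open>A singular system has value 0/0, which loses the strict comparison with 1/0 and
    with any stored fraction; in this way the program rejects it.\<close>
  have zero: "val f = 0" if "den f = 0"
  proof -
    have "cd f = 0" using that by (simp add: den_def)
    thus ?thesis by (simp add: pval_def den_def nm_def dot_def)
  qed
  show ?thesis unfolding keep_prog_def
  proof (rule wp_Cond[OF B0], goal_cases)
    case 1
    hence ok: "\<forall>i<n + m. lhs f i \<ge> 0" and less: "val f * s 17 0 < s 16 0 * den f" using s by auto
    have "den f \<noteq> 0" using less zero by force
    hence feas: "feas f" using ok den_nonneg[of f] by (simp add: feas_def)
    have opt: "val f * den h \<le> val h * den f" if h: "h \<in> S" "feas h" for h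
    proof -
      from b obtain g where g: "feas g" "s 17 0 = den g" "s 16 0 = val g" "val g * den h \<le> val h * den g"
        using h unfolding best_def by blast
      show ?thesis
        by (rule fraction_le_trans[of _ "den g" "val g"]) (use less g feas h in \<open>auto simp: feas_def\<close>)
    qed
    let ?s = "s(16 := (s 16)(0 := val f), 17 := (s 17)(0 := den f))"
    have "wp L B (For 8 nE (Assign 1 (Plus (ctr 8) (Lit 3)) (Cell 15 (ctr 8)))) ?s (best (insert f S))"
    proof (rule wp_For[where N = n and I = "\<lambda>k s'. \<forall>i<k. s' 1 (int i + 3) = of_bool (buy f i)"], goal_cases)
      case 3
      show ?case using int_less_power2[of n L B] L by simp
    next
      case (5 s')
      have "s' 0 = s 0" using 5[of 0] by simp
      thus ?case using st by simp
    next
      case (8 k s')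
      have "s' 15 = s 15" using 8(4)[of 15] by simp
      hence "s' 15 (int k) = of_bool (buy f k)" using s(4) 8(1) by simp
      thus ?case using 8(2,3) B0 by (intro wp_Assign[OF B0]) (auto simp: less_Suc_eq)
    next
      case (9 s')
      have "s' 16 0 = val f" "s' 17 0 = den f" using 9(2) by auto
      thus ?case using 9(1) f feas opt unfolding best_def by blast
    qed (use L B0 in auto)
    moreover have "\<bar>s 12 0\<bar> < 2 ^ B" "\<bar>s 11 0\<bar> < 2 ^ B" using bd by (auto simp: bounded_cells_def)
    ultimately show ?case using s by (intro wp_Seq wp_Assign[OF B0]) auto
  next
    case 2
    hence nless: "(\<forall>i<n + m. lhs f i \<ge> 0) \<Longrightarrow> \<not> val f * s 17 0 < s 16 0 * den f" using s by auto
    show ?case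
    proof (rule wp_Skip, cases "feas f")
      case False
      thus "best (insert f S) s" using b unfolding best_def by blast
    next
      case True
      hence "s 16 0 * den f \<le> val f * s 17 0" using nless by (auto simp: feas_def)
      moreover have "0 < den f" using True by (simp add: feas_def)
      ultimately show "best (insert f S) s" using b unfolding best_def by auto
    qed
  qed
qed

lemma box_Suc: "box (Suc k) r = (\<Union>i<choices k. box k (r(k := i)))"
proof (intro equalityI subsetI)
  fix f assume f: "f \<in> box (Suc k) r"
  hence "f \<in> box k (r(k := f k))" "f k < choices k" by (auto simp: box_def less_Suc_eq)
  thus "f \<in> (\<Union>i<choices k. box k (r(k := i)))" by blast
next
  fix f assume "f \<in> (\<Union>i<choices k. box k (r(k := i)))"
  then obtain i where i: "i < choices k" "f \<in> box k (r(k := i))" by blast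
  hence fk: "f k = i" by (auto simp: box_def)
  show "f \<in> box (Suc k) r" unfolding box_def
  proof (intro CollectI conjI allI impI)
    fix j assume "j < Suc k"
    thus "f j < choices j" using i fk by (cases "j = k") (auto simp: box_def)
  next
    fix j assume "Suc k \<le> j"
    hence "k \<le> j" "j \<noteq> k" by auto
    thus "f j = r j" using i(2) by (auto simp: box_def)
  qed
qed

text \<open>Induction on the nesting depth. \<open>S\<close> and \<open>r\<close> are generalised
  since each run of the inner loops starts from the candidates of earlier rounds and from one more
  fixed counter; the box splits accordingly by \<open>box_Suc\<close>.\<close>

lemma wp_search:
  assumes "k \<le> m + m" "stored s" "best S s"
    and "\<And>j. k \<le> j \<Longrightarrow> j < m + m \<Longrightarrow> r j < choices j \<and> s (selA j) 0 = int (r j)"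
  shows "wp L B (search_prog m k) s (best (S \<union> box k r))"
  using assms
proof (induction k arbitrary: s S r)
  case 0
  have v: "valid r" using 0(4) by (simp add: valid_def)
  have box: "box 0 r = {r}" by (auto simp: box_def)
  show ?case unfolding search_prog.simps box
  proof (rule wp_Seq, rule wp_conseq[OF wp_eval[OF 0(2) v]], goal_cases)
    case (1 k)
    thus ?case using 0(4) by simp
  next
    case (2 s')
    have "s' 0 = s 0" "s' 1 = s 1" "s' 16 = s 16" "s' 17 = s 17" using 2(2) by (auto simp: mods_eval)
    hence "best S s'" "s' 0 1 = int n" using best_cong[OF 0(3)] 0(2) by (auto simp: stored_def)
    thus ?case using wp_keep[of s' r S] v 2(3) by simp
  qed
next
  case (Suc k)
  have ma: "x \<notin> mods (search_prog m k)" if "x \<in> {0, 2, 3, 6, 7} \<or> (\<exists>j. x = colA j) \<or> (\<exists>j\<ge>k. x = selA j)" for x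
    using that by (auto simp: mods_search mods_eval mods_keep) presburger+
  have sm: "stored s'" if "stored s0" "\<And>a. a \<notin> insert (selA k) (mods (search_prog m k)) \<Longrightarrow> s' a = s0 a" for s0 s'
  proof (rule stored_cong[OF that(1)])
    fix j
    have "colA j \<noteq> selA k" by presburger
    thus "s' (colA j) = s0 (colA j)" using that(2) ma by auto
  qed (use that(2) ma in auto)
  show ?case unfolding search_prog.simps
  proof (rule wp_For[where N = "choices k" and I = "\<lambda>i s'. best (S \<union> (\<Union>i'<i. box k (r(k := i')))) s'"], goal_cases)
    case 2
    show ?case using L by (auto simp: choices_def)
  next
    case 3
    have "choices k \<le> L" using L by (auto simp: choices_def)
    thus ?case using int_less_power2 L by blast
  next
    case 4
    show ?case using ma by blast
  next
    case (5 s')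
    have "s' 0 = s 0" by (rule 5) (use ma in auto)
    thus ?case using Suc.prems(2) by (auto simp: stored_def colsE_def choices_def)
  next
    case (6 i s' y)
    thus ?case by (elim best_cong) auto
  next
    case (8 i s')
    have "wp L B (search_prog m k) s' (best ((S \<union> (\<Union>i'<i. box k (r(k := i')))) \<union> box k (r(k := i))))"
    proof (rule Suc.IH[OF _ _ 8(2)])
      show "stored s'" using sm[OF Suc.prems(2) 8(4)] by blast
    next
      fix j assume j: "k \<le> j" "j < m + m"
      show "(r(k := i)) j < choices j \<and> s' (selA j) 0 = int ((r(k := i)) j)"
      proof (cases "j = k")
        case False
        hence "s' (selA j) = s (selA j)" using j ma by (intro 8(4)) auto
        thus ?thesis using Suc.prems(4)[of j] j False by simp
      qed (use 8 in auto)
    qed (use Suc.prems in simp)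
    moreover have "S \<union> (\<Union>i'<i. box k (r(k := i'))) \<union> box k (r(k := i)) = S \<union> (\<Union>i'<Suc i. box k (r(k := i')))"
      by (auto simp: less_Suc_eq)
    ultimately show ?case by simp
  next
    case (9 s')
    thus ?case by (simp add: box_Suc)
  qed (use Suc.prems B0 in auto)
qed

end

text \<open>The stored fraction is \<open>D\<close> times the optimal cost, hence the factor
  \<open>D\<close> in the denominator of the output.\<close>

definition finish_prog :: com where
  "finish_prog =
    Seq (Assign 1 (Lit 0) (Plus nE (Lit 2)))
   (Seq (Assign 1 (Lit 1) (ctr 16)) (Assign 1 (Lit 2) (Times (ctr 2) (ctr 17))))"

definition optimize_prog :: "nat \<Rightarrow> com" where
  "optimize_prog m = Seq (Assign 16 (Lit 0) (Lit 1)) (Seq (search_prog m (m + m)) finish_prog)"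

definition solver :: "nat \<Rightarrow> com" where
  "solver m = Seq (scale_prog m) (Seq (table_prog m) (optimize_prog m))"

context scaled_data
begin

definition best_candidate :: "(nat \<Rightarrow> nat) \<Rightarrow> bool" where
  "best_candidate g \<longleftrightarrow> feas g \<and> (\<forall>f\<in>box (m + m) (\<lambda>_. 0). feas f \<longrightarrow> val g * den f \<le> val f * den g)"

end

lemma (in machine_data) wp_optimize:
  assumes st: "stored s" and zero: "s 17 0 = 0" and f: "f \<in> box (m + m) (\<lambda>_. 0)" "feas f"
  shows "wp L B (optimize_prog m) s (\<lambda>s'. \<exists>g. best_candidate g \<and> s' 1 0 = int n + 2 \<and>
    s' 1 1 = val g \<and> s' 1 2 = D * den g \<and> (\<forall>i<n. s' 1 (int i + 3) = of_bool (buy g i)))"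
proof -
  let ?s = "s(16 := (s 16)(0 := 1))"
  have "wp L B (search_prog m (m + m)) ?s (best ({} \<union> box (m + m) (\<lambda>_. 0)))"
    by (rule wp_search) (use zero in \<open>auto intro!: stored_cong[OF st] simp: best_def\<close>)
  hence "wp L B (Seq (search_prog m (m + m)) finish_prog) ?s (\<lambda>s'. \<exists>g. best_candidate g \<and> s' 1 0 = int n + 2 \<and>
    s' 1 1 = val g \<and> s' 1 2 = D * den g \<and> (\<forall>i<n. s' 1 (int i + 3) = of_bool (buy g i)))"
  proof (rule wp_Seq[OF wp_conseq], goal_cases)
    case (1 s')
    obtain g where g: "valid g" "feas g" "s' 17 0 = den g" "s' 16 0 = val g"
      "\<forall>i<n. s' 1 (int i + 3) = of_bool (buy g i)"
      "\<forall>f\<in>box (m + m) (\<lambda>_. 0). feas f \<longrightarrow> val g * den f \<le> val f * den g"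
      using 1(3) f unfolding best_def by auto
    have "s' x = ?s x" if "x \<in> {0, 2}" for x
      by (rule 1(2)) (use that in \<open>auto simp: mods_search mods_eval mods_keep\<close>)
    hence "s' 0 = s 0" "s' 2 = s 2" by auto
    hence s': "s' 0 1 = int n" "s' 2 0 = D" using st by (auto simp: stored_def)
    have "\<bar>D * den g\<bar> \<le> X * Y\<^sup>2"
      unfolding abs_mult using X(1) D_pos den_bound[OF g(1)] X1 by (intro mult_mono) auto
    hence "\<bar>D * den g\<bar> < 2 ^ B" by (rule bound_one)
    moreover have "int n + 2 < 2 ^ B" using int_less_power2[of "n + 2" L B] L by simp
    moreover have "\<bar>val g\<bar> < 2 ^ B" using pval_bound[OF g(1)] by simp
    ultimately show ?case
      using g s' unfolding finish_prog_def
      by (intro wp_Seq wp_Assign[OF B0]) (auto simp: best_candidate_def intro!: exI[of _ g])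
  qed
  thus ?thesis unfolding optimize_prog_def
    by (intro wp_Seq[where c = "Assign _ _ _"] wp_Assign[OF B0]) (simp_all add: B0)
qed

section \<open>Layout of the scaled data and correctness of the whole program\<close>

definition cdata :: "nat \<Rightarrow> (nat \<Rightarrow> int) \<Rightarrow> nat \<Rightarrow> int" where
  "cdata n V i = (if i < n then V i else 0)"

definition ldata :: "nat \<Rightarrow> (nat \<Rightarrow> int) \<Rightarrow> nat \<Rightarrow> int" where
  "ldata n V i = (if i < n then V (n + i) else 0)"

definition adata :: "nat \<Rightarrow> (nat \<Rightarrow> int) \<Rightarrow> int \<Rightarrow> nat \<Rightarrow> nat \<Rightarrow> int" where
  "adata n V D i j = (if i < n then V (n * (j + 2) + i) else if i = n + j then D else 0)"

definition bdata :: "nat \<Rightarrow> nat \<Rightarrow> (nat \<Rightarrow> int) \<Rightarrow> nat \<Rightarrow> int" where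
  "bdata m n V j = V ((m + 2) * n + j)"

lemma scaled_data_of_list:
  "0 < D \<Longrightarrow> scaled_data m n (adata n V D) (cdata n V) (ldata n V) D"
  by unfold_locales (auto simp: adata_def cdata_def ldata_def)

lemma entry_index: "i < n \<Longrightarrow> j < m \<Longrightarrow> n * (j + 2) + i < (m + 2) * n + (m::nat)"
proof -
  assume "i < n" "j < m"
  hence "n * (j + 2) + i < n * (j + 3)" by (simp add: algebra_simps)
  also have "\<dots> \<le> n * (m + 2)" using \<open>j < m\<close> by (intro mult_left_mono) auto
  finally show ?thesis by (simp add: algebra_simps)
qed

text \<open>If \<open>X = 2 ^ (2 * L)\<close> bounds the scaled data, then determinants are at most \<open>fact m * X ^ m\<close> and all cells
  are less than \<open>(n + 2 * m + 1) * X * (fact m * X ^ m)\<^sup>2\<close>, whose binary logarithm is estimated here.\<close>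

definition bits :: "nat \<Rightarrow> nat poly" where
  "bits m = [:m + 2 * fact m + 1, 4 * m + 3:]"

text \<open>The feasible \<open>f\<close> in the box rules out that the search ends with the initial
  1/0.\<close>

lemma wp_solver:
  fixes p q :: "nat \<Rightarrow> int" and m n L B :: nat
  defines "M \<equiv> (m + 2) * n + m"
  defines "D \<equiv> prod q {..<M}" and "V \<equiv> (\<lambda>k. p k * prod q ({..<M} - {k}))"
  assumes B: "B = poly (bits m) L" and len: "2 + 2 * M \<le> L"
    and n: "s 0 1 = int n"
    and pq: "\<And>k. k < M \<Longrightarrow> s 0 (2 * int k + 3) = p k" "\<And>k. k < M \<Longrightarrow> s 0 (2 * int k + 4) = q k"
    and p: "\<And>k. k < M \<Longrightarrow> \<bar>p k\<bar> \<le> 2 ^ L" and q: "\<And>S. S \<subseteq> {..<M} \<Longrightarrow> \<bar>prod q S\<bar> \<le> 2 ^ L"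
    and qpos: "\<And>k. k < M \<Longrightarrow> 0 < q k"
    and fresh: "\<And>x. 2 \<le> x \<Longrightarrow> s x = (\<lambda>_. 0)"
    and f: "f \<in> scaled_data.box m n (m + m) (\<lambda>_. 0)" "scaled_data.feas m n (adata n V D) D f"
  shows "wp L B (solver m) s (\<lambda>s'. \<exists>g.
    scaled_data.best_candidate m n (adata n V D) (cdata n V) (ldata n V) (bdata m n V) D g \<and> s' 1 0 = int n + 2 \<and>
    s' 1 1 = scaled_data.pval m (adata n V D) (cdata n V) (ldata n V) (bdata m n V) D g (n + m) \<and>
    s' 1 2 = D * scaled_data.den m (adata n V D) g \<and>
    (\<forall>i<n. s' 1 (int i + 3) = of_bool (scaled_data.buy m (adata n V D) (cdata n V) (ldata n V) D g i)))"
  (is "wp L B _ s ?Q")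
proof -
  \<comment> \<open>One factor \<open>2 ^ L\<close> is for a numerator, the other for the product of
    the remaining denominators.\<close>
  define X :: int where "X = 2 ^ (2 * L)"
  define Y where "Y = fact m * X ^ m"
  have D: "0 < D" unfolding D_def by (rule prod_pos) (use qpos in auto)
  have DX: "D \<le> X"
  proof -
    have "D \<le> 2 ^ L" using q[of "{..<M}"] unfolding D_def by simp
    also have "\<dots> \<le> X" unfolding X_def by (rule power_increasing) auto
    finally show ?thesis .
  qed
  have VX: "\<bar>V k\<bar> \<le> X" if "k < M" for k
  proof -
    have "\<bar>V k\<bar> \<le> 2 ^ L * 2 ^ L"
      unfolding V_def abs_mult by (rule mult_mono) (use that p q in auto)
    thus ?thesis by (simp add: X_def power_add mult_2)
  qed
  have X0: "0 \<le> X" by (simp add: X_def)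
  have nM: "n + m \<le> M" "2 * n \<le> M" unfolding M_def by simp_all
  have LB: "2 * L < B" "n + m + 2 \<le> L" "L \<le> B" unfolding B bits_def using len nM
    by (auto simp: algebra_simps trans_le_add2)
  interpret machine_data m n "adata n V D" "cdata n V" "ldata n V" "bdata m n V" D L B X Y
  proof (intro machine_data.intro scaled_data_of_list D, unfold_locales)
    fix i j assume "i < n + m" "j < m"
    thus "\<bar>adata n V D i j\<bar> \<le> X"
      using VX entry_index[of i n j m] DX D X0 by (auto simp: adata_def M_def)
  next
    fix i assume "i < n + m"
    thus "\<bar>cdata n V i\<bar> \<le> X" "\<bar>ldata n V i\<bar> \<le> X"
      using VX nM X0 by (auto simp: cdata_def ldata_def)
  next
    fix j assume "j < m"
    thus "\<bar>bdata m n V j\<bar> \<le> X" using VX by (auto simp: bdata_def M_def)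
  next
    have fm: "fact m \<le> (2::int) ^ fact m"
      using of_nat_mono[OF less_imp_le[OF less_exp[of "fact m"]], where 'a = int] by simp
    have lm: "int (n + m) + int m + 1 < 2 ^ (L + m)"
      using int_less_power2[of "L + m" "L + m" "L + m"] LB by simp
    have Y: "Y \<le> 2 ^ (fact m + 2 * L * m)" "0 < Y"
      using fm by (auto simp: Y_def X_def power_add power_mult[symmetric])
    have "X * Y\<^sup>2 \<le> 2 ^ (2 * L) * (2 ^ (fact m + 2 * L * m))\<^sup>2"
      unfolding X_def using Y by (intro mult_left_mono power_mono) auto
    also have "\<dots> = 2 ^ (2 * L + 2 * fact m + 4 * L * m)"
      by (simp add: power_add[symmetric] power_mult[symmetric] algebra_simps)
    finally have XY: "X * Y\<^sup>2 \<le> 2 ^ (2 * L + 2 * fact m + 4 * L * m)" .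
    have "(int (n + m) + int m + 1) * (X * Y\<^sup>2) \<le> 2 ^ (L + m) * 2 ^ (2 * L + 2 * fact m + 4 * L * m)"
      using lm XY X0 by (intro mult_mono) auto
    \<comment> \<open>The exponents add up to \<open>(4 * m + 3) * L + m + 2 * fact m\<close>, one
      less than \<open>poly (bits m) L\<close>.\<close>
    also have "\<dots> < 2 ^ B"
      unfolding power_add[symmetric] B bits_def by (intro power_strict_increasing) (auto simp: algebra_simps)
    finally show "(int (n + m) + int m + 1) * (X * (fact m * X ^ m)\<^sup>2) < 2 ^ B" unfolding Y_def .
  next
    show "Y \<equiv> fact m * X ^ m" by (rule eq_reflection[OF Y_def])
  qed (use DX LB in auto)
  have fr1: "mods (scale_prog m) = {2, 3, 4, 5}" by (auto simp: scale_prog_def mods_For)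
  show ?thesis unfolding solver_def
  proof (rule wp_Seq, rule wp_conseq[OF wp_scale[OF LB(1), where s = s and n = n and M = M and p = p and q = q]], goal_cases)
    case (8 s1)
    have z: "s1 x = (\<lambda>_. 0)" if "6 \<le> x" for x using 8(2)[of x] fresh[of x] that by (auto simp: fr1)
    have n1: "s1 0 1 = int n" using 8(2)[of 0] n by (simp add: fr1)
    have nB: "n \<le> L" "int n < 2 ^ B" using int_less_power2[of n L B] LB by auto
    show ?case
    proof (rule wp_Seq, rule wp_conseq[OF wp_table[OF B0 nB, where s = s1 and m = m]], goal_cases)
      case (5 s2)
      have e: "s2 0 = s1 0" "s2 2 = s1 2" "s2 3 = s1 3" "s2 17 = s1 17"
        by (rule 5(2); auto simp: mods_table)+
      have V: "s1 3 (int k) = V k" if "k < M" for k using 8(3) that by (simp add: V_def)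
      have "stored s2" unfolding stored_def
      proof (intro conjI allI impI)
        show "s2 0 1 = int n" "s2 2 0 = D" using e n1 8(3) by (auto simp: D_def)
        fix i assume i: "i < n + m"
        have "i < M" "i < n \<Longrightarrow> n + i < M" using i nM by auto
        thus "s2 6 (int i) = cdata n V i" "s2 7 (int i) = ldata n V i"
          using 5(3) i V by (auto simp: cdata_def ldata_def simp del: of_nat_add)
      next
        fix i j assume ij: "i < n + m" "j < m"
        show "s2 (colA j) (int i) = adata n V D i j"
          using 5(3) ij V[of "n * (j + 2) + i"] entry_index[of i n j m] 8(3)
          by (auto simp: adata_def M_def D_def simp del: of_nat_add of_nat_mult)
      next
        fix j assume "j < m"
        hence "s1 3 (int ((m + 2) * n + j)) = V ((m + 2) * n + j)" by (intro V) (simp add: M_def)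
        thus "s2 3 ((int m + 2) * int n + int j) = bdata m n V j"
          unfolding e bdata_def by (simp add: algebra_simps)
      qed
      moreover have "s2 17 0 = 0" using e z by simp
      ultimately show ?case using f by (rule wp_optimize)
    qed (use z n1 in auto)
  qed (use M_def len pq p q n in auto)
qed

section \<open>Rational instances\<close>

lemma concat_nth_uniform:
  assumes "\<forall>xs\<in>set xss. length xs = n" "j < length xss" "i < n"
  shows "concat xss ! (n * j + i) = xss ! j ! i"
  using assms
proof (induction xss arbitrary: j)
  case (Cons xs xss)
  show ?case
  proof (cases j)
    case 0
    thus ?thesis using Cons.prems by (simp add: nth_append)
  next
    case (Suc j')
    have "concat (xs # xss) ! (n * j + i) = concat xss ! (n * j' + i)"
      using Cons.prems Suc by (simp add: nth_append)
    thus ?thesis using Cons Suc by simp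
  qed
qed simp

lemma length_concat_uniform:
  "\<forall>xs\<in>set xss. length xs = n \<Longrightarrow> length (concat xss) = n * length xss"
  by (induction xss) auto

lemma enc_rat_eq: "enc_rat r = [fst (quotient_of r), snd (quotient_of r)]"
  by (simp add: enc_rat_def split: prod.split)

lemma list_size_append: "list_size (xs @ ys) = list_size xs + list_size ys"
  by (simp add: list_size_def)

lemma list_size_enc_rats:
  "list_size (concat (map enc_rat rs)) =
    (\<Sum>k<length rs. int_size (fst (quotient_of (rs ! k))) + int_size (snd (quotient_of (rs ! k))))"
proof (induction rs)
  case (Cons r rs)
  show ?case unfolding length_Cons sum.lessThan_Suc_shift
    using Cons by (simp add: list_size_append enc_rat_eq) (simp add: list_size_def)
qed (simp add: list_size_def)

lemma length_le_list_size: "length w \<le> list_size w"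
proof (induction w)
  case (Cons z w)
  thus ?case using int_size_pos[of z] by (simp add: list_size_def)
qed simp

lemma int_size_le_list_size: "z \<in> set w \<Longrightarrow> int_size z \<le> list_size w"
  by (induction w) (auto simp: list_size_def)

lemma abs_less_power_int_size: "\<bar>z\<bar> < 2 ^ int_size z"
  using int_size_le_iff[of z "int_size z"] by simp

text \<open>Lengths add up under multiplication, so the plain product of all denominators is no
  longer than the input and can replace their least common multiple.\<close>

lemma prod_int_size:
  "finite S \<Longrightarrow> \<bar>prod q S\<bar> \<le> 2 ^ (\<Sum>k\<in>S. int_size (q k))"
proof (induction S rule: finite_induct)
  case (insert k S)
  have "\<bar>q k\<bar> * \<bar>prod q S\<bar> \<le> 2 ^ int_size (q k) * 2 ^ (\<Sum>k\<in>S. int_size (q k))"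
    using insert less_imp_le[OF abs_less_power_int_size[of "q k"]] by (intro mult_mono) auto
  thus ?case using insert by (simp add: abs_mult power_add)
qed simp

lemma bounded_input_store:
  assumes "list_size w \<le> B"
  shows "bounded_cells B (input_store w)"
proof -
  have "\<bar>z\<bar> < 2 ^ B" if "z \<in> set w" for z
  proof -
    have "int_size z \<le> B" using int_size_le_list_size[OF that] assms by simp
    hence "(2::int) ^ int_size z \<le> 2 ^ B" by (rule power_increasing) simp
    thus ?thesis using abs_less_power_int_size[of z] by linarith
  qed
  moreover have "int (length w) < 2 ^ B"
    using int_less_power2[of "length w" B B] length_le_list_size[of w] assms by simp
  moreover have "w ! (nat i - 1) \<in> set w" if "1 \<le> i" "i \<le> int (length w)" for i
    using that by (intro nth_mem) linarith
  ultimately show ?thesis by (auto simp: bounded_cells_def input_store_def)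
qed

lemma list_size_output:
  assumes "has_output s v" "bounded_cells B s"
  shows "list_size v \<le> length v * (B + 1)"
proof -
  have "int_size z \<le> B + 1" if "z \<in> set v" for z
  proof -
    obtain i where i: "i < length v" "v ! i = z" using \<open>z \<in> set v\<close> unfolding in_set_conv_nth by blast
    hence "s 1 (int i + 1) = z" using assms(1) unfolding has_output_def by blast
    hence "\<bar>z\<bar> < 2 ^ B" using assms(2) unfolding bounded_cells_def by blast
    thus ?thesis using int_size_le_iff[of z B] by simp
  qed
  hence "list_size v \<le> (\<Sum>z\<leftarrow>v. B + 1)"
    unfolding list_size_def by (intro sum_list_mono) blast
  thus ?thesis by (simp add: sum_list_triv)
qed

definition rats :: "rtst_hp \<Rightarrow> rat list" where
  "rats I = list_of_vec (first_costs I) @ list_of_vec (nominal_costs I) @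
     concat (map list_of_vec (rows (constr_mat I))) @ list_of_vec (constr_rhs I)"

lemma concat_enc_vec: "concat (map enc_vec vs) = concat (map enc_rat (concat (map list_of_vec vs)))"
  by (induction vs) (simp_all add: enc_vec_def)

lemma enc_eq_rats:
  "enc_rtst_hp I = [int (dim_vec (first_costs I)), int (dim_row (constr_mat I))] @ concat (map enc_rat (rats I))"
  unfolding enc_rtst_hp_def rats_def concat_enc_vec enc_vec_def by simp

locale rtst_instance =
  fixes I :: rtst_hp and m n :: nat
  assumes dims: "first_costs I \<in> carrier_vec n" "nominal_costs I \<in> carrier_vec n"
      "constr_mat I \<in> carrier_mat m n" "constr_rhs I \<in> carrier_vec m"
    and nonempty: "rU I \<noteq> {}" and bounded: "bounded_vecs n (rU I)"
begin

definition M :: nat where "M = (m + 2) * n + m"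
definition num :: "nat \<Rightarrow> int" where "num k = fst (quotient_of (rats I ! k))"
definition dnm :: "nat \<Rightarrow> int" where "dnm k = snd (quotient_of (rats I ! k))"

lemma rats_props:
  shows length_rats: "length (rats I) = M"
    and rats_first: "i < n \<Longrightarrow> rats I ! i = first_costs I $ i"
    and rats_nominal: "i < n \<Longrightarrow> rats I ! (n + i) = nominal_costs I $ i"
    and rats_constr: "i < n \<Longrightarrow> j < m \<Longrightarrow> rats I ! (n * (j + 2) + i) = constr_mat I $$ (j, i)"
    and rats_rhs: "j < m \<Longrightarrow> rats I ! ((m + 2) * n + j) = constr_rhs I $ j"
proof -
  let ?R = "map list_of_vec (rows (constr_mat I))"
  have u: "\<forall>xs\<in>set ?R. length xs = n" using dims(3) by (auto simp: rows_def)
  have lR: "length ?R = m" using dims(3) by simp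
  note len = length_concat_uniform[OF u, unfolded lR]
  have d: "dim_vec (first_costs I) = n" "dim_vec (nominal_costs I) = n" "dim_vec (constr_rhs I) = m"
    using dims by auto
  show "length (rats I) = M" unfolding rats_def M_def by (simp add: len d)
  show "i < n \<Longrightarrow> rats I ! i = first_costs I $ i" unfolding rats_def
    by (simp add: nth_append d list_of_vec_index)
  show "i < n \<Longrightarrow> rats I ! (n + i) = nominal_costs I $ i" unfolding rats_def
    by (simp add: nth_append d list_of_vec_index)
  show "j < m \<Longrightarrow> rats I ! ((m + 2) * n + j) = constr_rhs I $ j" unfolding rats_def
    by (simp add: nth_append d len list_of_vec_index algebra_simps)
  show "rats I ! (n * (j + 2) + i) = constr_mat I $$ (j, i)" if ij: "i < n" "j < m"
  proof -
    have "n * j + i < n * m"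
      using entry_index[OF ij] mult_le_mono2[of "Suc j" m n] ij by simp
    hence "rats I ! (n * (j + 2) + i) = concat ?R ! (n * j + i)"
      unfolding rats_def by (simp add: nth_append d len)
    also have "\<dots> = ?R ! j ! i" by (rule concat_nth_uniform[OF u]) (use ij lR in auto)
    also have "\<dots> = constr_mat I $$ (j, i)" using ij dims(3) by (simp add: list_of_vec_index)
    finally show ?thesis .
  qed
qed

lemma dnm_pos: "0 < dnm k"
  unfolding dnm_def using quotient_of_denom_pos'[of "rats I ! k"] by simp

lemma rat_quotient: "real_of_rat (rats I ! k) = of_int (num k) / of_int (dnm k)"
proof -
  have "rats I ! k = of_int (num k) / of_int (dnm k)"
    by (rule quotient_of_div) (simp add: num_def dnm_def)
  thus ?thesis by (simp add: of_rat_divide)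
qed

definition D :: int where "D = prod dnm {..<M}"
definition V :: "nat \<Rightarrow> int" where "V k = num k * prod dnm ({..<M} - {k})"

lemma D_positive: "0 < D" unfolding D_def by (rule prod_pos) (use dnm_pos in auto)

lemma V_eq: "k < M \<Longrightarrow> real_of_int (V k) = of_int D * of_rat (rats I ! k)"
  unfolding V_def D_def rat_quotient using dnm_pos[of k]
  by (subst prod.remove[of "{..<M}" k]) simp_all

sublocale scaled_data m n "adata n V D" "cdata n V" "ldata n V" "bdata m n V" D
  by (rule scaled_data_of_list) (rule D_positive)

lemma index_bounds: "i < n \<Longrightarrow> i < M" "i < n \<Longrightarrow> n + i < M"
    "i < n \<Longrightarrow> j < m \<Longrightarrow> n * (j + 2) + i < M" "j < m \<Longrightarrow> (m + 2) * n + j < M"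
  using entry_index[of i n j m] by (auto simp: M_def)

lemma cdata_eq: "i < n \<Longrightarrow> real_of_int (cdata n V i) = of_int D * rC I $ i"
  using dims by (simp add: cdata_def V_eq index_bounds rats_first rC_def)

lemma ldata_eq: "i < n \<Longrightarrow> real_of_int (ldata n V i) = of_int D * of_rat (nominal_costs I $ i)"
  by (simp add: ldata_def V_eq index_bounds rats_nominal)

lemma scenarios_iff:
  "d \<in> scenarios \<longleftrightarrow> (\<forall>i<n. 0 \<le> d i) \<and>
    (\<forall>j<m. (\<Sum>i<n. of_rat (constr_mat I $$ (j, i)) * d i) \<le> of_rat (constr_rhs I $ j))"
proof -
  have "dot n (\<lambda>i. real_of_int (adata n V D i j)) d \<le> of_int (bdata m n V j) \<longleftrightarrow>
    (\<Sum>i<n. of_rat (constr_mat I $$ (j, i)) * d i) \<le> of_rat (constr_rhs I $ j)" if j: "j < m" for j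
  proof -
    have "dot n (\<lambda>i. real_of_int (adata n V D i j)) d = of_int D * (\<Sum>i<n. of_rat (constr_mat I $$ (j, i)) * d i)"
      unfolding dot_def sum_distrib_left
    proof (rule sum.cong)
      fix i assume "i \<in> {..<n}"
      hence "i < n" by simp
      thus "real_of_int (adata n V D i j) * d i = of_int D * (of_rat (constr_mat I $$ (j, i)) * d i)"
        using j index_bounds(3)[of i j] rats_constr[of i j] by (simp add: adata_def V_eq)
    qed simp
    moreover have "real_of_int (bdata m n V j) = of_int D * of_rat (constr_rhs I $ j)"
      using j index_bounds(4)[of j] rats_rhs[of j] by (simp add: bdata_def V_eq)
    ultimately show ?thesis using D_positive by simp
  qed
  thus ?thesis unfolding scenarios_def by auto
qed

abbreviation cl :: "real vec" where "cl \<equiv> map_vec of_rat (nominal_costs I)"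

lemma rU_eq: "rU I = (\<lambda>d. cl + vec n d) ` scenarios"
proof (intro equalityI subsetI)
  have mv: "(map_mat real_of_rat (constr_mat I) *\<^sub>v \<delta>) $ j = (\<Sum>i<n. of_rat (constr_mat I $$ (j, i)) * \<delta> $ i)"
    if "\<delta> \<in> carrier_vec n" "j < m" for \<delta> j
    using that dims by (simp add: scalar_prod_def lessThan_atLeast0)
  {
    fix c assume "c \<in> rU I"
    then obtain \<delta> where \<delta>: "c = cl + \<delta>" "\<delta> \<in> carrier_vec n"
        "map_mat of_rat (constr_mat I) *\<^sub>v \<delta> \<le> map_vec of_rat (constr_rhs I)" "\<delta> \<ge> 0\<^sub>v n"
      using dims by (auto simp: rU_def U_HP_def)
    have "(\<lambda>i. \<delta> $ i) \<in> scenarios"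
      unfolding scenarios_iff using \<delta>(2,3,4) mv[OF \<delta>(2)] dims
      by (auto simp: less_eq_vec_def simp del: index_mult_mat_vec)
    moreover have "vec n (\<lambda>i. \<delta> $ i) = \<delta>" using \<delta>(2) by auto
    ultimately show "c \<in> (\<lambda>d. cl + vec n d) ` scenarios"
      using \<delta>(1) by (intro image_eqI[where x = "\<lambda>i. \<delta> $ i"]) simp_all
  next
    fix c assume "c \<in> (\<lambda>d. cl + vec n d) ` scenarios"
    then obtain d where d: "c = cl + vec n d" "d \<in> scenarios" by blast
    have "map_mat of_rat (constr_mat I) *\<^sub>v vec n d \<le> map_vec of_rat (constr_rhs I)" "vec n d \<ge> 0\<^sub>v n"
      using d(2) mv[of "vec n d"] dims unfolding scenarios_iff
      by (auto simp: less_eq_vec_def simp del: index_mult_mat_vec)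
    thus "c \<in> rU I" using d(1) dims unfolding rU_def U_HP_def by auto
  }
qed

section \<open>Optimality of the best candidate for a rational instance\<close>

definition bvec :: "(nat \<Rightarrow> bool) \<Rightarrow> real vec" where
  "bvec y = vec n (\<lambda>i. of_bool (y i))"

text \<open>\<open>D\<close> times the total cost of \<open>y\<close> under the single deviation
  \<open>d\<close>; the nominal second-stage costs are part of \<open>fixed_cost\<close>.\<close>

definition worst :: "(nat \<Rightarrow> bool) \<Rightarrow> (nat \<Rightarrow> real) \<Rightarrow> real" where
  "worst y d = fixed_cost y + of_int D * dot n (\<lambda>i. if y i then 0 else 1) d"

lemma dim_rC: "dim_vec (rC I) = n" using dims by (simp add: rC_def)

lemma cost_eq: "of_int D * (rC I \<bullet> bvec y + (cl + vec n d) \<bullet> (vec n (\<lambda>_. 1) - bvec y)) = worst y d"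
proof -
  have 1: "rC I \<bullet> bvec y = (\<Sum>i<n. rC I $ i * of_bool (y i))"
    by (simp add: scalar_prod_def bvec_def lessThan_atLeast0)
  have 2: "(cl + vec n d) \<bullet> (vec n (\<lambda>_. 1) - bvec y) =
      (\<Sum>i<n. (of_rat (nominal_costs I $ i) + d i) * (1 - of_bool (y i)))"
    using dims by (simp add: scalar_prod_def bvec_def lessThan_atLeast0)
  show ?thesis
    unfolding 1 2 worst_def fixed_cost_def dot_def sum.distrib[symmetric] sum_distrib_left
    by (rule sum.cong) (auto simp: cdata_eq ldata_eq algebra_simps)
qed

text \<open>The supremum in the cost enters the argument only as a least upper bound, through these
  two rules: boundedness of the uncertainty set gives the first, nonemptiness the second.\<close>

lemma cost_bounds:
  shows cost_upper: "d \<in> scenarios \<Longrightarrow> worst y d \<le> of_int D * rtst_cost (rC I) (rU I) (bvec y)"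
    and cost_least: "(\<And>d. d \<in> scenarios \<Longrightarrow> worst y d \<le> t) \<Longrightarrow> of_int D * rtst_cost (rC I) (rU I) (bvec y) \<le> t"
proof -
  let ?h = "\<lambda>c. c \<bullet> (vec n (\<lambda>_. 1) - bvec y)"
  have D: "0 < real_of_int D" using D_positive by simp
  obtain K where K: "\<forall>c\<in>rU I. \<forall>i<n. \<bar>c $ i\<bar> \<le> K" using bounded unfolding bounded_vecs_def by blast
  have "?h c \<le> (\<Sum>i<n. K)" if "c \<in> rU I" for c
  proof -
    have "?h c = (\<Sum>i<n. c $ i * (1 - of_bool (y i)))"
      by (simp add: scalar_prod_def bvec_def lessThan_atLeast0)
    also have "\<dots> \<le> (\<Sum>i<n. K)"
    proof (rule sum_mono)
      fix i assume "i \<in> {..<n}"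
      hence "\<bar>c $ i\<bar> \<le> K" using K that by simp
      thus "c $ i * (1 - of_bool (y i)) \<le> K" by (cases "y i") auto
    qed
    finally show ?thesis .
  qed
  hence bdd: "bdd_above (?h ` rU I)" by (intro bdd_aboveI2)
  have cost: "rtst_cost (rC I) (rU I) (bvec y) = rC I \<bullet> bvec y + (SUP c\<in>rU I. ?h c)"
    by (simp add: rtst_cost_def dim_rC)
  show "worst y d \<le> of_int D * rtst_cost (rC I) (rU I) (bvec y)" if "d \<in> scenarios"
  proof -
    have "?h (cl + vec n d) \<le> (SUP c\<in>rU I. ?h c)"
      by (rule cSUP_upper[OF _ bdd]) (use that rU_eq in blast)
    thus ?thesis unfolding cost cost_eq[symmetric] using D by simp
  qed
  show "of_int D * rtst_cost (rC I) (rU I) (bvec y) \<le> t" if "\<And>d. d \<in> scenarios \<Longrightarrow> worst y d \<le> t"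
  proof -
    have "(SUP c\<in>rU I. ?h c) \<le> t / of_int D - rC I \<bullet> bvec y"
    proof (rule cSUP_least[OF nonempty])
      fix c assume "c \<in> rU I"
      then obtain d where d: "c = cl + vec n d" "d \<in> scenarios" using rU_eq by blast
      have "of_int D * (rC I \<bullet> bvec y + ?h c) \<le> t" using that[OF d(2)] cost_eq[of y d] d(1) by simp
      hence "rC I \<bullet> bvec y + ?h c \<le> t / of_int D" using D by (simp add: pos_le_divide_eq mult.commute)
      thus "?h c \<le> t / of_int D - rC I \<bullet> bvec y" by simp
    qed
    hence "of_int D * (rC I \<bullet> bvec y + (SUP c\<in>rU I. ?h c)) \<le> of_int D * (t / of_int D)"
      using D by (intro mult_left_mono) auto
    thus ?thesis unfolding cost using D by simp
  qed
qed

lemma scenarios_nonempty: "scenarios \<noteq> {}" using nonempty rU_eq by simp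

lemma candidate_exists:
  "\<exists>f\<in>box (m + m) (\<lambda>_. 0). feas f \<and> of_int (val f) / of_int (den f) \<le> of_int D * rtst_cost (rC I) (rU I) (bvec y)"
proof -
  obtain d0 where d0: "d0 \<in> scenarios" using scenarios_nonempty by blast
  have D: "0 < real_of_int D" using D_positive by simp
  \<comment> \<open>The part of the cost of \<open>y\<close> that is due to the deviations in the
    worst case.\<close>
  let ?z = "rtst_cost (rC I) (rU I) (bvec y) - fixed_cost y / of_int D"
  have "dot n (\<lambda>i. if y i then 0 else 1) d \<le> ?z" if "d \<in> scenarios" for d
  proof -
    have "of_int D * dot n (\<lambda>i. if y i then 0 else 1) d \<le> of_int D * ?z"
      using cost_upper[OF that, of y] D unfolding worst_def by (simp add: right_diff_distrib)
    thus ?thesis using D by simp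
  qed
  from candidate_complete[OF d0 this]
  obtain f where "f \<in> box (m + m) (\<lambda>_. 0)" "feas f"
    "of_int (val f) / of_int (den f) \<le> fixed_cost y + of_int D * ?z" by blast
  thus ?thesis using D by (auto simp: right_diff_distrib)
qed

text \<open>A sandwich: the scaled cost of \<open>buy g\<close> is at most
  \<open>val g / den g\<close> by soundness, and that is at most the scaled cost of every
  \<open>y\<close> by completeness. Taking \<open>y = buy g\<close> turns the first bound into an
  equality.\<close>

lemma best_candidate_optimal:
  assumes g: "best_candidate g"
  shows "rtst_optimal (rC I) (rU I) (bvec (buy g))"
    and "rtst_cost (rC I) (rU I) (bvec (buy g)) = of_int (val g) / of_int (D * den g)"
proof -
  have D: "0 < real_of_int D" using D_positive by simp
  have feas: "feas g" "0 < real_of_int (den g)" using g by (auto simp: best_candidate_def feas_def)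
  let ?v = "real_of_int (val g) / of_int (den g)"
  have upper: "of_int D * rtst_cost (rC I) (rU I) (bvec (buy g)) \<le> ?v"
    unfolding worst_def by (rule cost_least) (simp add: worst_def candidate_sound[OF feas(1)])
  have lower: "?v \<le> of_int D * rtst_cost (rC I) (rU I) (bvec y)" for y
  proof -
    obtain f where f: "f \<in> box (m + m) (\<lambda>_. 0)" "feas f"
      "of_int (val f) / of_int (den f) \<le> of_int D * rtst_cost (rC I) (rU I) (bvec y)"
      using candidate_exists by blast
    have "val g * den f \<le> val f * den g" using g f by (auto simp: best_candidate_def)
    hence "real_of_int (val g) * of_int (den f) \<le> of_int (val f) * of_int (den g)"
      by (simp flip: of_int_mult)
    moreover have "0 < real_of_int (den f)" using f(2) by (simp add: feas_def)
    ultimately have "?v \<le> of_int (val f) / of_int (den f)"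
      using feas by (simp add: divide_simps mult.commute)
    thus ?thesis using f(3) by linarith
  qed
  have eq: "of_int D * rtst_cost (rC I) (rU I) (bvec (buy g)) = ?v" using upper lower by (rule antisym)
  have "rtst_cost (rC I) (rU I) (bvec (buy g)) = ?v / of_int D"
    unfolding eq[symmetric] using D by simp
  thus "rtst_cost (rC I) (rU I) (bvec (buy g)) = of_int (val g) / of_int (D * den g)"
    by (simp add: mult.commute)
  show "rtst_optimal (rC I) (rU I) (bvec (buy g))"
    unfolding rtst_optimal_def is_arg_min_linorder dim_rC
  proof (intro conjI allI impI)
    show "bvec (buy g) \<in> binary_vecs n" by (auto simp: bvec_def binary_vecs_def)
    fix x assume x: "x \<in> binary_vecs n"
    have "x = bvec (\<lambda>i. x $ i = 1)"
      using x by (intro eq_vecI) (auto simp: bvec_def binary_vecs_def)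
    moreover have "of_int D * rtst_cost (rC I) (rU I) (bvec (buy g)) \<le>
        of_int D * rtst_cost (rC I) (rU I) (bvec (\<lambda>i. x $ i = 1))" using upper lower by (rule order_trans)
    ultimately show "rtst_cost (rC I) (rU I) (bvec (buy g)) \<le> rtst_cost (rC I) (rU I) x"
      using D by simp
  qed
qed

lemma solver_correct:
  defines "L \<equiv> list_size (enc_rtst_hp I)"
  defines "B \<equiv> poly (bits m) L"
  shows "\<exists>t s v. exec (solver m) (input_store (enc_rtst_hp I)) t s \<and> has_output s v \<and> rtst_hp_solution I v \<and>
    t \<le> ccost (solver m) L B \<and> list_size v \<le> L * (B + 1)"
proof -
  let ?w = "enc_rtst_hp I" and ?R = "concat (map enc_rat (rats I))"
  have w: "?w = [int n, int m] @ ?R" using dims by (simp add: enc_eq_rats)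
  have u: "\<forall>xs\<in>set (map enc_rat (rats I)). length xs = 2" by (auto simp: enc_rat_eq)
  have lenw: "length ?w = 2 + 2 * M" using length_concat_uniform[OF u] by (simp add: w length_rats)
  have len: "2 + 2 * M \<le> L" using length_le_list_size[of ?w] unfolding L_def lenw .
  have R: "?R ! (2 * k + i) = enc_rat (rats I ! k) ! i" if "k < M" "i < 2" for k i
    using concat_nth_uniform[OF u, of k i] that by (simp add: length_rats)
  let ?s = "input_store ?w"
  have cell: "?s 0 (int i + 1) = ?w ! i" if "i < length ?w" for i
    using that by (auto simp: input_store_def nat_add_distrib)
  have s_n: "?s 0 1 = int n" using cell[of 0] lenw by (simp add: w)
  have s_num: "?s 0 (2 * int k + 3) = num k" if "k < M" for k
    using cell[of "2 * k + 2"] R[of k 0] that by (simp add: lenw) (simp add: w num_def enc_rat_eq nth_append add.commute)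
  have s_dnm: "?s 0 (2 * int k + 4) = dnm k" if "k < M" for k
    using cell[of "2 * k + 3"] R[of k 1] that by (simp add: lenw) (simp add: w dnm_def enc_rat_eq nth_append add.commute)
  \<comment> \<open>All numerators and denominators share the budget \<open>L\<close>, which is why
    even the product of all denominators stays below \<open>2 ^ L\<close>.\<close>
  have sizes: "(\<Sum>k<M. int_size (num k) + int_size (dnm k)) \<le> L"
    using list_size_enc_rats[of "rats I"] unfolding L_def w list_size_append
    by (simp add: length_rats num_def dnm_def)
  have num: "\<bar>num k\<bar> \<le> 2 ^ L" if "k < M" for k
  proof -
    have "int_size (num k) + int_size (dnm k) \<le> (\<Sum>k<M. int_size (num k) + int_size (dnm k))"
      by (rule member_le_sum) (use that in auto)
    hence "(2::int) ^ int_size (num k) \<le> 2 ^ L" using sizes by (intro power_increasing) auto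
    thus ?thesis using abs_less_power_int_size[of "num k"] by linarith
  qed
  have dnm: "\<bar>prod dnm S\<bar> \<le> 2 ^ L" if S: "S \<subseteq> {..<M}" for S
  proof -
    have "(\<Sum>k\<in>S. int_size (dnm k)) \<le> (\<Sum>k<M. int_size (dnm k))" by (rule sum_mono2) (use S in auto)
    also have "\<dots> \<le> (\<Sum>k<M. int_size (num k) + int_size (dnm k))" by (rule sum_mono) simp
    finally have "(2::int) ^ (\<Sum>k\<in>S. int_size (dnm k)) \<le> 2 ^ L" using sizes by (intro power_increasing) auto
    thus ?thesis using prod_int_size[of S dnm] finite_subset[OF S] by (meson finite_lessThan order_trans)
  qed
  obtain f where f: "f \<in> box (m + m) (\<lambda>_. 0)" "feas f" using candidate_exists by blast
  have fresh: "?s x = (\<lambda>_. 0)" if "2 \<le> x" for x using that by (auto simp: input_store_def)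
  have V_fun: "V = (\<lambda>k. num k * prod dnm ({..<M} - {k}))" by (rule ext) (rule V_def)
  have "wp L B (solver m) ?s (\<lambda>s'. \<exists>g. best_candidate g \<and> s' 1 0 = int n + 2 \<and> s' 1 1 = val g \<and>
      s' 1 2 = D * den g \<and> (\<forall>i<n. s' 1 (int i + 3) = of_bool (buy g i)))"
    unfolding V_fun D_def M_def
    by (rule wp_solver[where p = num and q = dnm and s = ?s and m = m and n = n and L = L and B = B and f = f,
          OF meta_eq_to_obj_eq[OF B_def] len[unfolded M_def] s_n s_num[unfolded M_def]
          s_dnm[unfolded M_def] num[unfolded M_def] dnm[unfolded M_def] dnm_pos fresh
          f(1) f(2)[unfolded V_fun D_def M_def]])
  moreover have "L \<le> B" by (simp add: B_def bits_def algebra_simps trans_le_add2)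
  hence "bounded_cells B ?s" by (intro bounded_input_store) (simp add: L_def)
  ultimately obtain t s g where ts: "exec (solver m) ?s t s" "t \<le> ccost (solver m) L B" "bounded_cells B s"
    and g: "best_candidate g" "s 1 0 = int n + 2" "s 1 1 = val g" "s 1 2 = D * den g"
      "\<forall>i<n. s 1 (int i + 3) = of_bool (buy g i)" unfolding wp_def by blast
  let ?xs = "map (\<lambda>i. of_bool (buy g i)) [0..<n]"
  let ?v = "val g # D * den g # ?xs"
  have out: "has_output s ?v" unfolding has_output_def
  proof (intro conjI allI impI)
    fix i assume i: "i < length ?v"
    consider "i = 0" | "i = 1" | k where "i = Suc (Suc k)" "k < n"
      using i by (cases i; cases "i - 1") auto
    thus "s 1 (int i + 1) = ?v ! i"
      by cases (use g in \<open>auto simp: add.commute\<close>)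
  qed (use g in simp)
  have sol: "rtst_hp_solution I ?v" unfolding rtst_hp_solution_def
  proof (intro exI conjI)
    show "0 < D * den g" using g(1) D_positive by (simp add: best_candidate_def feas_def)
    have "map_vec real_of_int (vec_of_list ?xs) = bvec (buy g)"
      by (intro eq_vecI) (auto simp: bvec_def vec_of_list_index)
    thus "let x = map_vec real_of_int (vec_of_list ?xs) in rtst_optimal (rC I) (rU I) x \<and>
        rtst_cost (rC I) (rU I) x = of_int (val g) / of_int (D * den g)"
      using best_candidate_optimal[OF g(1)] by simp
  qed simp
  have "list_size ?v \<le> (n + 2) * (B + 1)" using list_size_output[OF out ts(3)] by simp
  also have "\<dots> \<le> L * (B + 1)" using len by (intro mult_right_mono) (auto simp: M_def)
  finally show ?thesis using ts out sol by blast
qed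

end

theorem theorem5:
  fixes m :: nat
  shows "poly_time_solvable (rtst_hp_instances m) enc_rtst_hp rtst_hp_solution"
proof -
  obtain r :: "nat poly" where r: "\<And>L. ccost (solver m) L (poly (bits m) L) = poly r L"
    using ccost_poly by blast
  show ?thesis unfolding poly_time_solvable_def
  \<comment> \<open>The summand \<open>r\<close> bounds the running time. The other bounds the
    output size: at most \<open>L\<close> entries, each of size at most
    \<open>poly (bits m) L + 1\<close>, where \<open>L\<close> is the input size.\<close>
  proof (intro exI[of _ "solver m"] exI[of _ "r + [:0, 1:] * (bits m + 1)"] ballI)
    fix I assume "I \<in> rtst_hp_instances m"
    then obtain n where "rtst_instance I m n"
      unfolding rtst_hp_instances_def rtst_instance_def by blast
    from rtst_instance.solver_correct[OF this] obtain t s v where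
      "exec (solver m) (input_store (enc_rtst_hp I)) t s" "has_output s v" "rtst_hp_solution I v"
      "t \<le> poly r (list_size (enc_rtst_hp I))"
      "list_size v \<le> list_size (enc_rtst_hp I) * (poly (bits m) (list_size (enc_rtst_hp I)) + 1)"
      unfolding r by blast
    thus "\<exists>t s v. exec (solver m) (input_store (enc_rtst_hp I)) t s \<and> has_output s v \<and> rtst_hp_solution I v \<and>
        t + list_size v \<le> poly (r + [:0, 1:] * (bits m + 1)) (list_size (enc_rtst_hp I))"
      by (intro exI[of _ t] exI[of _ s] exI[of _ v]) (simp add: add_mono)
  qed
qed

end
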